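(* Let $n=1$, $s\in(0,1)$ and $K(x):=|x|^{-1-2s}$, with associated operator $L_s u(x)=\mathrm{PV}\int_{\mathbb{R}}\frac{u(y)-u(x)}{|x-y|^{1+2s}}\,dy$. Then there exist a potential $W:\mathbb{R}\to[0,+\infty)$ satisfying (W1) $W\in C^{2,\vartheta}_{\rm loc}(\mathbb{R})$ for some $\vartheta>0$, with $W(\pm1)=W'(\pm1)=0$; (W2) $W(t)>0$ for all $t\in(-1,1)$; (W3) there exist $c_2\ge c_1>0$, $c_4\ge c_3>0$, $\mu\in(0,1)$, $\alpha\ge\beta\ge2$ and $\gamma\ge\delta\ge2$ such that $c_1(1+t)^{\alpha-2}\le W''(t)\le c_2(1+t)^{\beta-2}$ for $t\in(-1,-1+\mu]$ and $c_3(1-t)^{\gamma-2}\le W''(t)\le c_4(1-t)^{\delta-2}$ for $t\in[1-\mu,1)$, with exponents satisfying $\max\{\alpha-\beta,\gamma-\delta\}<1$ and $\min\{\beta,\delta\}\ge5$, and a function $\widetilde u\in\mathcal{X}$ such that $L_s\widetilde u=W'(\widetilde u)$ in $\mathbb{R}$. Moreover, there exist positive constants $C_1,C_2$ and diverging sequences of positive real numbers $x_k$, $y_k$, $z_k$ such that $$1-\widetilde u(x_k)=C_2x_k^{-\frac{2s}{\gamma-1}},\quad 1-\widetilde u(y_k)=C_1y_k^{-\frac{2s}{\delta-1}},$$ $$1+\widetilde u(-x_k)=C_2|x_k|^{-\frac{2s}{\alpha-1}},\quad 1+\widetilde u(-y_k)=C_1|y_k|^{-\frac{2s}{\beta-1}},$$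 $$\widetilde u'(z_k)=C_1z_k^{-\left(1+\frac{2s(\gamma-\delta+1)}{\gamma-1}\right)},\quad \widetilde u'(-z_k)=C_1|z_k|^{-\left(1+\frac{2s(\alpha-\beta+1)}{\alpha-1}\right)}.$$
   Context: $\mathcal{X}$ denotes the set of $f\in L^1_{\rm loc}(\mathbb{R})$ with $\lim_{x\to\pm\infty}f(x)=\pm1$. PV denotes the Cauchy principal value. *)

theory Defs
  imports "HOL-Analysis.Analysis"
begin

definition in_X :: "(real \<Rightarrow> real) \<Rightarrow> bool" where
  "in_X u \<longleftrightarrow> (\<forall>K. compact K \<longrightarrow> set_integrable lborel K u)
      \<and> (u \<longlongrightarrow> 1) at_top \<and> (u \<longlongrightarrow> -1) at_bot"

definition frac_trunc :: "real \<Rightarrow> (real \<Rightarrow> real) \<Rightarrow> real \<Rightarrow> real \<Rightarrow> real" where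
  "frac_trunc s u x \<epsilon> =
     (LINT y:{y. \<epsilon> < \<bar>y - x\<bar>}|lborel. (u y - u x) / \<bar>x - y\<bar> powr (1 + 2 * s))"

definition frac_PV_eq :: "real \<Rightarrow> (real \<Rightarrow> real) \<Rightarrow> real \<Rightarrow> real \<Rightarrow> bool" where
  "frac_PV_eq s u x L \<longleftrightarrow>
     (\<forall>\<epsilon>>0. set_integrable lborel {y. \<epsilon> < \<bar>y - x\<bar>}
                (\<lambda>y. (u y - u x) / \<bar>x - y\<bar> powr (1 + 2 * s)))
     \<and> ((\<lambda>\<epsilon>. frac_trunc s u x \<epsilon>) \<longlongrightarrow> L) (at_right 0)"

definition C2_holder_loc :: "real \<Rightarrow> (real \<Rightarrow> real) \<Rightarrow> bool" where
  "C2_holder_loc \<theta> W \<longleftrightarrow>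
     (\<forall>x. W differentiable at x) \<and> (\<forall>x. deriv W differentiable at x) \<and>
     (\<forall>K. compact K \<longrightarrow> (\<exists>C. \<forall>x\<in>K. \<forall>y\<in>K.
        \<bar>deriv (deriv W) x - deriv (deriv W) y\<bar> \<le> C * \<bar>x - y\<bar> powr \<theta>))"

end

theory Submission
  imports Defs "HOL-Complex_Analysis.Complex_Analysis" "HOL-Real_Asymp.Real_Asymp"
begin

text \<open>
  For \<open>Re z > 0\<close> the integral over \<open>h > 0\<close> of
  \<open>(Ln (z + \<i> h) + Ln (z - \<i> h) - 2 Ln z) h powr (-1 - 2 s)\<close> is holomorphic in \<open>z\<close> and homogeneous
  of degree \<open>-2 s\<close>, hence a positive multiple of \<open>z powr (-2 s)\<close>. Its imaginary part at
  \<open>z = l + \<i> x\<close> computes the fractional Laplacian of \<open>arctan (x / l)\<close>.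

  Take for \<open>u\<close> the mixture of these profiles with scales \<open>l\<^sub>j\<close> in geometric progression and weights
  proportional to \<open>l\<^sub>j powr (-s / 2)\<close>. Then \<open>1 - u\<close> is comparable to \<open>x powr (-s / 2)\<close>, so \<open>W'\<close>, which
  is forced by the equation, behaves near \<open>1\<close> like \<open>- (1 - t) ^ 4\<close>, and all four exponents
  can be taken equal to \<open>5\<close>. Since the ratio of the scales is large, \<open>x powr (s / 2) * (1 - u x)\<close> and
  \<open>x powr (1 + s / 2) * u' x\<close> oscillate and both take the value \<open>1 / 5\<close> along diverging sequences.
\<close>

section \<open>A fractional integral of the logarithm\<close>

text \<open>A single arctangent cannot serve: its tail is of order \<open>1 / x\<close>, so the
  prescribed decay \<open>x powr (-2 s / (\<gamma> - 1))\<close> would force \<gamma> = 1 + 2s,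
  which is below 5. Averaging over unbounded scales makes the tail heavier without changing the
  order of the right-hand side: every profile joins -1 to 1, so its fractional Laplacian decays like
  \<open>x powr (-2 s)\<close> whatever the scale. Matching \<open>x powr (-2 s)\<close> with
  \<open>(1 - u) ^ (\<gamma> - 1)\<close> at \<gamma> = 5 dictates the tail exponent s/2, hence the
  weights. The equation is then read backwards: along u, W'' has to be the derivative of the
  right-hand side divided by u'. For (W3) and the regularity of W, bounds up to constants suffice,
  and these survive the oscillation. The oscillation itself is wanted because the constant C1 is
  shared by the tail at y_k and the slope at z_k. For a pure power tail
  \<open>C * x powr (- s / 2)\<close> the slope constant would be C s/2, which is not C. Oscillation
  lets tail and slope cross one common level infinitely often. Equal exponents allow x_k = y_k, and
  oddness of u settles the left half-line.\<close>

lemma has_field_derivative_integral: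
  fixes f f' :: "complex \<Rightarrow> 'a \<Rightarrow> complex" and g :: "'a \<Rightarrow> real"
  assumes S: "open S" "convex S" "z0 \<in> S"
    and deriv: "\<And>z h. z \<in> S \<Longrightarrow> ((\<lambda>z. f z h) has_field_derivative f' z h) (at z)"
    and bound: "\<And>z h. z \<in> S \<Longrightarrow> norm (f' z h) \<le> g h"
    and int: "\<And>z. z \<in> S \<Longrightarrow> integrable M (f z)"
    and g: "integrable M g"
    and meas: "f' z0 \<in> borel_measurable M"
  shows "((\<lambda>z. integral\<^sup>L M (f z)) has_field_derivative integral\<^sup>L M (f' z0)) (at z0)"
proof -
  \<comment> \<open>The mean value inequality on the convex set \<open>S\<close> turns the bound on
    the derivative into the bound \<open>g h\<close> for all difference quotients, so dominated
    convergence applies along any sequence tending to \<open>z0\<close>.\<close>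
  have lip: "norm (f z h - f z0 h) \<le> g h * norm (z - z0)" if "z \<in> S" for z h
    using S that by (intro field_differentiable_bound[of S _ "\<lambda>z. f' z h"])
      (auto intro: bound has_field_derivative_at_within deriv)
  have "((\<lambda>z. (integral\<^sup>L M (f z) - integral\<^sup>L M (f z0)) / (z - z0)) \<longlongrightarrow> integral\<^sup>L M (f' z0))
          (at z0 within S)"
    unfolding tendsto_at_iff_sequentially
  proof (intro allI impI)
    fix X :: "nat \<Rightarrow> complex"
    assume X: "\<forall>i. X i \<in> S - {z0}" "X \<longlonglongrightarrow> z0"
    have lim: "(\<lambda>i. \<integral>h. (f (X i) h - f z0 h) / (X i - z0) \<partial>M) \<longlonglongrightarrow> integral\<^sup>L M (f' z0)"
    proof (rule integral_dominated_convergence)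
      show "f' z0 \<in> borel_measurable M" by (rule meas)
      show "integrable M g" by (rule g)
      show "(\<lambda>h. (f (X i) h - f z0 h) / (X i - z0)) \<in> borel_measurable M" for i
        using int[of "X i"] int[of z0] X S(3) by (auto intro!: borel_measurable_integrable)
      show "AE h in M. (\<lambda>i. (f (X i) h - f z0 h) / (X i - z0)) \<longlonglongrightarrow> f' z0 h"
      proof (rule AE_I2)
        fix h
        have "((\<lambda>z. (f z h - f z0 h) / (z - z0)) \<longlongrightarrow> f' z0 h) (at z0 within S)"
          using has_field_derivative_at_within[OF deriv[OF S(3)], of h S]
          by (simp add: has_field_derivative_iff)
        then show "(\<lambda>i. (f (X i) h - f z0 h) / (X i - z0)) \<longlonglongrightarrow> f' z0 h"
          using X unfolding tendsto_at_iff_sequentially by (simp add: o_def)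
      qed
      show "AE h in M. norm ((f (X i) h - f z0 h) / (X i - z0)) \<le> g h" for i
        using lip[of "X i"] X by (auto intro!: AE_I2 simp: norm_divide divide_le_eq)
    qed
    have eq: "(\<integral>h. (f (X i) h - f z0 h) / (X i - z0) \<partial>M)
        = (integral\<^sup>L M (f (X i)) - integral\<^sup>L M (f z0)) / (X i - z0)" for i
    proof -
      have "integrable M (f (X i))" using int X by blast
      from Bochner_Integration.integral_diff[OF this int[OF S(3)]] show ?thesis by simp
    qed
    show "((\<lambda>z. (integral\<^sup>L M (f z) - integral\<^sup>L M (f z0)) / (z - z0)) \<circ> X)
        \<longlonglongrightarrow> integral\<^sup>L M (f' z0)"
      unfolding o_def using lim[unfolded eq] .
  qed
  then show ?thesis
    unfolding has_field_derivative_iff at_within_open[OF S(3) S(1)] .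
qed

section \<open>Integrability against the singular kernel\<close>

lemma integrable_powr_near_0:
  fixes a :: real
  assumes "a > -1"
  shows "integrable lborel (\<lambda>h. indicator {0<..1} h * h powr a)"
proof -
  have "(\<lambda>h. h powr a) absolutely_integrable_on {0..1}"
    using has_integral_powr_from_0[OF assms, of 1]
    by (intro nonnegative_absolutely_integrable_1) (auto simp: integrable_on_def)
  then have "set_integrable lborel {0..1} (\<lambda>h. h powr a)"
    unfolding set_integrable_def by (subst integrable_completion[symmetric]) auto
  then have "set_integrable lborel {0<..1} (\<lambda>h. h powr a)"
    by (rule set_integrable_subset) auto
  then show ?thesis by (simp add: set_integrable_def)
qed

lemma integrable_powr_near_inf:
  fixes a e :: real
  assumes "a < -1" "e > 0"
  shows "integrable lborel (\<lambda>h. indicator {e<..} h * h powr a)"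
proof -
  have "(\<lambda>h. h powr a) absolutely_integrable_on {e..}"
    using has_integral_powr_to_inf[OF assms]
    by (intro nonnegative_absolutely_integrable_1) (auto simp: integrable_on_def)
  then have "set_integrable lborel {e..} (\<lambda>h. h powr a)"
    unfolding set_integrable_def by (subst integrable_completion[symmetric]) auto
  then have "set_integrable lborel {e<..} (\<lambda>h. h powr a)"
    by (rule set_integrable_subset) auto
  then show ?thesis by (simp add: set_integrable_def)
qed

text \<open>Supported on the positive half-line because the principal value is folded: pairing
  \<open>x + h\<close> with \<open>x - h\<close> replaces it by an absolutely convergent integral of
  symmetric second differences.\<close>

definition frac_kernel :: "real \<Rightarrow> real \<Rightarrow> real" where
  "frac_kernel s h = indicator {0<..} h * h powr (-1 - 2 * s)"

lemma frac_kernel_nonneg: "0 \<le> frac_kernel s h"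
  by (simp add: frac_kernel_def)

lemma frac_kernel_measurable [measurable]: "frac_kernel s \<in> borel_measurable borel"
  unfolding frac_kernel_def by measurable

lemma frac_kernel_scale:
  assumes "t > 0"
  shows "frac_kernel s (t * h) = t powr (-1 - 2 * s) * frac_kernel s h"
  using assms by (auto simp: frac_kernel_def powr_mult zero_less_mult_iff split: split_indicator)

text \<open>The growth \<open>h powr s\<close> allowed at infinity leaves room for logarithms.\<close>

lemma integrable_frac_kernel_bound:
  fixes f :: "real \<Rightarrow> 'b::{banach, second_countable_topology}"
  assumes s: "0 < s" "s < 1" and [measurable]: "f \<in> borel_measurable borel"
    and b0: "\<And>h. 0 < h \<Longrightarrow> h \<le> 1 \<Longrightarrow> norm (f h) \<le> A * h\<^sup>2"
    and b1: "\<And>h. 1 < h \<Longrightarrow> norm (f h) \<le> B * h powr s"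
  shows "integrable lborel (\<lambda>h. frac_kernel s h *\<^sub>R f h)"
proof (rule Bochner_Integration.integrable_bound)
  show "integrable lborel (\<lambda>h. A * (indicator {0<..1} h * h powr (1 - 2 * s))
      + B * (indicator {1<..} h * h powr (-1 - s)))"
    using s by (intro Bochner_Integration.integrable_add integrable_mult_right
      integrable_powr_near_0 integrable_powr_near_inf) auto
  show "(\<lambda>h. frac_kernel s h *\<^sub>R f h) \<in> borel_measurable lborel" by simp
  have bd: "norm (frac_kernel s h *\<^sub>R f h) \<le> A * (indicator {0<..1} h * h powr (1 - 2 * s))
      + B * (indicator {1<..} h * h powr (-1 - s))" for h
  proof -
    consider "h \<le> 0" | "0 < h" "h \<le> 1" | "1 < h" by linarith
    then show ?thesis
    proof cases
      case 2
      have "h powr (-1 - 2 * s) * norm (f h) \<le> h powr (-1 - 2 * s) * (A * h\<^sup>2)"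
        using b0[OF 2] by (intro mult_left_mono) auto
      also have "\<dots> = A * h powr (1 - 2 * s)"
        using 2 by (simp add: powr_numeral[symmetric] powr_add[symmetric] del: powr_numeral)
      finally show ?thesis using 2 by (simp add: frac_kernel_def)
    next
      case 3
      have "h powr (-1 - 2 * s) * norm (f h) \<le> h powr (-1 - 2 * s) * (B * h powr s)"
        using b1[OF 3] by (intro mult_left_mono) auto
      also have "\<dots> = B * h powr (-1 - 2 * s + s)"
        using 3 by (simp only: powr_add) simp
      also have "-1 - 2 * s + s = -1 - s" by simp
      finally show ?thesis using 3 by (simp add: frac_kernel_def)
    qed (simp add: frac_kernel_def)
  qed
  show "AE h in lborel. norm (frac_kernel s h *\<^sub>R f h) \<le>
      norm (A * (indicator {0<..1} h * h powr (1 - 2 * s)) + B * (indicator {1<..} h * h powr (-1 - s)))"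
    unfolding real_norm_def by (rule AE_I2) (rule order_trans[OF bd abs_ge_self])
qed

section \<open>Second differences of the logarithm\<close>

lemma norm_add_diff_le:
  fixes a b c :: "'a::real_normed_vector"
  shows "norm (a + b - c) \<le> norm a + norm b + norm c"
  using norm_triangle_ineq[of a b] norm_triangle_ineq4[of "a + b" c] by linarith

text \<open>The shifts are imaginary because the variable of the profile is the imaginary part of
  \<open>z\<close>. For \<open>Re z > 0\<close> all three points stay in the right half plane, away
  from the cut of \<open>Ln\<close>.\<close>

definition ln_diff2 :: "complex \<Rightarrow> real \<Rightarrow> complex" where
  "ln_diff2 z h = Ln (z + \<i> * of_real h) + Ln (z - \<i> * of_real h) - 2 * Ln z"

lemma measurable_ln_diff2 [measurable]:
  assumes "Re z > 0"
  shows "(\<lambda>h. ln_diff2 z h) \<in> borel_measurable borel"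
  unfolding ln_diff2_def using assms
  by (intro borel_measurable_continuous_onI continuous_intros) (auto simp: complex_nonpos_Reals_iff)

lemma norm_ge_right_half_plane: "Re z \<le> norm (z + \<i> * of_real h)" "Re z \<le> norm (z - \<i> * of_real h)"
  using complex_Re_le_cmod[of "z + \<i> * of_real h"] complex_Re_le_cmod[of "z - \<i> * of_real h"] by auto

text \<open>The derivative of \<open>Ln (z + \<i> * w) + Ln (z - \<i> * w)\<close> in
  \<open>w\<close> is \<open>2 * w / ((z + \<i> * w) * (z - \<i> * w))\<close>. It vanishes at
  \<open>w = 0\<close>, and for real \<open>w\<close> both factors have modulus at least
  \<open>Re z\<close>; one integration gives the quadratic bound.\<close>

lemma norm_ln_diff2_le:
  assumes "Re z > 0"
  shows "norm (ln_diff2 z h) \<le> 2 * h\<^sup>2 / (Re z)\<^sup>2"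
proof -
  let ?f = "\<lambda>w. Ln (z + \<i> * w) + Ln (z - \<i> * w)"
  let ?f' = "\<lambda>w. \<i> / (z + \<i> * w) - \<i> / (z - \<i> * w)"
  let ?S = "complex_of_real ` {-\<bar>h\<bar>..\<bar>h\<bar>}"
  have "norm (?f (of_real h) - ?f 0) \<le> 2 * \<bar>h\<bar> / (Re z)\<^sup>2 * norm (of_real h - (0::complex))"
  proof (rule field_differentiable_bound[where S = ?S and f' = ?f'])
    show "convex ?S"
      by (intro convex_linear_image linear_of_real) auto
    fix w :: complex assume "w \<in> ?S"
    then obtain k where k: "w = of_real k" "\<bar>k\<bar> \<le> \<bar>h\<bar>" by auto
    show "(?f has_field_derivative ?f' w) (at w within ?S)"
      using assms unfolding k
      by (auto intro!: derivative_eq_intros simp: complex_nonpos_Reals_iff field_simps)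
    have nz: "z + \<i> * w \<noteq> 0" "z - \<i> * w \<noteq> 0"
      using norm_ge_right_half_plane[of z k] assms k by auto
    have eq: "?f' w = 2 * w / ((z + \<i> * w) * (z - \<i> * w))"
      using nz by (simp add: divide_simps) (simp add: algebra_simps)
    have "(Re z)\<^sup>2 \<le> norm ((z + \<i> * w) * (z - \<i> * w))"
      using norm_ge_right_half_plane[of z k] assms k
      by (auto simp: norm_mult power2_eq_square intro!: mult_mono)
    then show "norm (?f' w) \<le> 2 * \<bar>h\<bar> / (Re z)\<^sup>2"
      unfolding eq norm_divide using k assms by (auto simp: norm_mult intro!: frac_le)
  qed (auto simp: image_iff intro: exI[of _ 0])
  then show ?thesis
    by (simp add: ln_diff2_def power2_eq_square)
qed

text \<open>Apply \<open>ln y <= y - 1\<close> to \<open>y = x powr s\<close> and to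
  \<open>y = x powr (-s)\<close>. The exponent \<open>s\<close> is the growth that the kernel still
  tolerates at infinity.\<close>

lemma abs_ln_le_powr:
  fixes x s :: real
  assumes "x > 0" "s > 0"
  shows "\<bar>ln x\<bar> \<le> (x powr s + x powr (-s)) / s"
proof -
  have "s * ln x \<le> x powr s" "s * (- ln x) \<le> x powr (-s)"
    using assms ln_le_minus_one[of "x powr s"] ln_le_minus_one[of "x powr (-s)"] by (simp_all add: ln_powr)
  moreover have "0 \<le> x powr s" "0 \<le> x powr (-s)" by auto
  ultimately have "s * ln x \<le> x powr s + x powr (-s)" "s * (- ln x) \<le> x powr s + x powr (-s)" by linarith+
  then have "\<bar>s * ln x\<bar> \<le> x powr s + x powr (-s)" by (auto simp: abs_if)
  then show ?thesis using assms by (simp add: abs_mult field_simps)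
qed

lemma norm_Ln_le_powr:
  assumes "0 < r" "r \<le> norm w" "norm w \<le> R" "s > 0"
  shows "norm (Ln w) \<le> (R powr s + r powr (-s)) / s + pi"
proof -
  have "w \<noteq> 0" using assms by auto
  have "norm (Ln w) \<le> \<bar>Re (Ln w)\<bar> + \<bar>Im (Ln w)\<bar>" by (rule cmod_le)
  also have "\<bar>Re (Ln w)\<bar> \<le> (norm w powr s + norm w powr (-s)) / s"
    using abs_ln_le_powr[of "norm w" s] assms \<open>w \<noteq> 0\<close> by simp
  also have "\<dots> \<le> (R powr s + r powr (-s)) / s"
    using assms by (intro divide_right_mono add_mono powr_mono2 powr_mono2') auto
  also have "\<bar>Im (Ln w)\<bar> \<le> pi"
    using Im_Ln_le_pi[OF \<open>w \<noteq> 0\<close>] mpi_less_Im_Ln[OF \<open>w \<noteq> 0\<close>] by linarith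
  finally show ?thesis by simp
qed

lemma integrable_ln_diff2:
  assumes s: "0 < s" "s < 1" and z: "Re z > 0"
  shows "integrable lborel (\<lambda>h. frac_kernel s h *\<^sub>R ln_diff2 z h)"
proof (rule integrable_frac_kernel_bound[OF s measurable_ln_diff2[OF z]])
  show "norm (ln_diff2 z h) \<le> 2 / (Re z)\<^sup>2 * h\<^sup>2" for h
    using norm_ln_diff2_le[OF z, of h] by simp
next
  fix h :: real assume h: "1 < h"
  define C where "C = (Re z powr (-s)) / s + pi"
  define R where "R = norm z + 1"
  have hs: "1 \<le> h powr s" using h s by (intro ge_one_powr_ge_zero) auto
  have C: "C \<ge> 0" using s by (simp add: C_def)
  have Rh: "norm z + h \<le> R * h" using h mult_left_mono[of 1 h "norm z"] by (simp add: R_def algebra_simps)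
  have "norm (\<i> * complex_of_real h) = h" using h by (simp add: norm_mult)
  then have n: "norm (z + \<i> * of_real h) \<le> R * h" "norm (z - \<i> * of_real h) \<le> R * h" "norm z \<le> R * h"
    using h norm_triangle_ineq[of z "\<i> * of_real h"] norm_triangle_ineq4[of z "\<i> * of_real h"] Rh
    by linarith+
  have b: "norm (Ln w) \<le> (R * h) powr s / s + C" if "Re z \<le> norm w" "norm w \<le> R * h" for w
    using norm_Ln_le_powr[OF z that \<open>0 < s\<close>] by (simp add: C_def add_divide_distrib)
  have "norm (ln_diff2 z h) \<le> norm (Ln (z + \<i> * of_real h)) + norm (Ln (z - \<i> * of_real h)) + norm (2 * Ln z)"
    unfolding ln_diff2_def by (rule norm_add_diff_le)
  also have "norm (2 * Ln z) = 2 * norm (Ln z)" by (simp add: norm_mult)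
  also have "norm (Ln (z + \<i> * of_real h)) + norm (Ln (z - \<i> * of_real h)) + 2 * norm (Ln z)
      \<le> 4 * ((R * h) powr s / s + C)"
  proof -
    have "a + b + 2 * c \<le> 4 * B" if "a \<le> B" "b \<le> B" "c \<le> B" for a b c B :: real
      using that by linarith
    from this[OF b[OF norm_ge_right_half_plane(1) n(1)] b[OF norm_ge_right_half_plane(2) n(2)]
        b[OF complex_Re_le_cmod n(3)]]
    show ?thesis .
  qed
  also have "(R * h) powr s = R powr s * h powr s"
    using h by (simp add: R_def powr_mult)
  also have "4 * (R powr s * h powr s / s + C) \<le> 4 * (R powr s * h powr s / s + C * h powr s)"
    using mult_left_mono[OF hs C] by simp
  also have "\<dots> = 4 * (R powr s / s + C) * h powr s" by (simp add: algebra_simps)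
  finally show "norm (ln_diff2 z h) \<le> 4 * ((norm z + 1) powr s / s + (Re z powr (-s) / s + pi)) * h powr s"
    by (simp add: C_def R_def)
qed

definition ln_diff2_deriv :: "complex \<Rightarrow> real \<Rightarrow> complex" where
  "ln_diff2_deriv z h = 1 / (z + \<i> * of_real h) + 1 / (z - \<i> * of_real h) - 2 / z"

lemma has_field_derivative_ln_diff2:
  assumes "Re z > 0"
  shows "((\<lambda>z. ln_diff2 z h) has_field_derivative ln_diff2_deriv z h) (at z)"
  using assms unfolding ln_diff2_def ln_diff2_deriv_def
  by (auto intro!: derivative_eq_intros simp: complex_nonpos_Reals_iff inverse_eq_divide)

text \<open>Over a common denominator the expression is
  \<open>- 2 * h\<^sup>2 / (z * (z + \<i> * h) * (z - \<i> * h))\<close>, which tames the kernel at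
  0; the constant bound serves for large \<open>h\<close>. Both depend on \<open>z\<close> only
  through \<open>r\<close>, as domination requires.\<close>

lemma norm_ln_diff2_deriv_le:
  assumes r: "0 < r" "r \<le> Re z"
  shows "norm (ln_diff2_deriv z h) \<le> 2 / r ^ 3 * h\<^sup>2" "norm (ln_diff2_deriv z h) \<le> 4 / r"
proof -
  let ?a = "z + \<i> * of_real h" and ?b = "z - \<i> * of_real h"
  have n: "r \<le> norm ?a" "r \<le> norm ?b" "r \<le> norm z"
    using norm_ge_right_half_plane[of z h] complex_Re_le_cmod[of z] r by linarith+
  have nz: "?a \<noteq> 0" "?b \<noteq> 0" "z \<noteq> 0" using n r by fastforce+
  have "ln_diff2_deriv z h = - 2 * (of_real h)\<^sup>2 / (z * (?a * ?b))"
    using nz unfolding ln_diff2_deriv_def by (simp add: divide_simps) (simp add: algebra_simps power2_eq_square)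
  then have "norm (ln_diff2_deriv z h) = 2 * h\<^sup>2 / (norm z * (norm ?a * norm ?b))"
    by (simp add: norm_divide norm_mult norm_power)
  also have "\<dots> \<le> 2 * h\<^sup>2 / (r * (r * r))"
    using n r by (intro divide_left_mono mult_mono mult_pos_pos) auto
  finally show "norm (ln_diff2_deriv z h) \<le> 2 / r ^ 3 * h\<^sup>2"
    by (simp add: power3_eq_cube)
  have "norm (ln_diff2_deriv z h) \<le> norm (1 / ?a) + norm (1 / ?b) + norm (2 / z)"
    unfolding ln_diff2_deriv_def by (rule norm_add_diff_le)
  also have "\<dots> \<le> 1 / r + 1 / r + 2 / r"
    unfolding norm_divide using n r by (intro add_mono frac_le) auto
  finally show "norm (ln_diff2_deriv z h) \<le> 4 / r" by simp
qed

definition ln_frac :: "real \<Rightarrow> complex \<Rightarrow> complex" where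
  "ln_frac s z = (\<integral>h. frac_kernel s h *\<^sub>R ln_diff2 z h \<partial>lborel)"

lemma ln_frac_holomorphic:
  assumes s: "0 < s" "s < 1"
  shows "ln_frac s holomorphic_on {z. Re z > 0}"
proof (rule holomorphic_onI)
  fix z0 :: complex assume "z0 \<in> {z. Re z > 0}"
  then have z0: "Re z0 > 0" by simp
  define r where "r = Re z0 / 2"
  have r: "0 < r" "r < Re z0" using z0 by (auto simp: r_def)
  let ?g = "\<lambda>h. frac_kernel s h *\<^sub>R (if h \<le> 1 then 2 / r ^ 3 * h\<^sup>2 else 4 / r)"
  have "((\<lambda>z. \<integral>h. frac_kernel s h *\<^sub>R ln_diff2 z h \<partial>lborel) has_field_derivative
      (\<integral>h. frac_kernel s h *\<^sub>R ln_diff2_deriv z0 h \<partial>lborel)) (at z0)"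
  proof (rule has_field_derivative_integral[where S = "{z. Re z > r}" and g = ?g])
    show "open {z. r < Re z}" by (rule open_halfspace_Re_gt)
    show "convex {z. r < Re z}" by (rule convex_halfspace_Re_gt)
    show "z0 \<in> {z. r < Re z}" using r by simp
    fix z h assume "z \<in> {z. r < Re z}"
    then have z: "r < Re z" by simp
    show "((\<lambda>z. frac_kernel s h *\<^sub>R ln_diff2 z h) has_field_derivative frac_kernel s h *\<^sub>R ln_diff2_deriv z h) (at z)"
      unfolding scaleR_conv_of_real using z r
      by (intro DERIV_cmult has_field_derivative_ln_diff2) auto
    show "norm (frac_kernel s h *\<^sub>R ln_diff2_deriv z h) \<le> ?g h"
      using norm_ln_diff2_deriv_le[of r z h] z r
      by (simp only: norm_scaleR real_scaleR_def real_norm_def abs_of_nonneg[OF frac_kernel_nonneg])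
        (auto simp: frac_kernel_nonneg simp del: times_divide_eq_right intro!: mult_left_mono)
  next
    fix z assume "z \<in> {z. r < Re z}"
    then show "integrable lborel (\<lambda>h. frac_kernel s h *\<^sub>R ln_diff2 z h)"
      using r by (intro integrable_ln_diff2 s) auto
  next
    show "integrable lborel ?g"
    proof (rule integrable_frac_kernel_bound[OF s])
      fix h :: real assume "1 < h"
      then have "4 / r * 1 \<le> 4 / r * h powr s"
        using s r by (intro mult_left_mono ge_one_powr_ge_zero) auto
      then show "norm (if h \<le> 1 then 2 / r ^ 3 * h\<^sup>2 else 4 / r) \<le> 4 / r * h powr s"
        using \<open>1 < h\<close> r by simp
    next
      show "norm (if h \<le> 1 then 2 / r ^ 3 * h\<^sup>2 else 4 / r) \<le> 2 / r ^ 3 * h\<^sup>2" if "h \<le> 1" for h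
        using that r by (simp add: abs_mult)
    qed simp
  next
    show "(\<lambda>h. frac_kernel s h *\<^sub>R ln_diff2_deriv z0 h) \<in> borel_measurable lborel"
      unfolding ln_diff2_deriv_def by measurable
  qed
  then have "(ln_frac s has_field_derivative (\<integral>h. frac_kernel s h *\<^sub>R ln_diff2_deriv z0 h \<partial>lborel)) (at z0)"
    by (simp add: ln_frac_def[abs_def])
  then show "ln_frac s field_differentiable at z0 within {z. 0 < Re z}"
    using field_differentiable_def field_differentiable_at_within by blast
qed

text \<open>Substitute \<open>t * h\<close> for \<open>h\<close>. Each logarithm gains
  \<open>ln t\<close>, and these cancel with coefficients 1 + 1 - 2; what remains is the Jacobian
  \<open>t\<close> times the kernel factor \<open>t powr (-1 - 2 * s)\<close>.\<close>

lemma ln_frac_scale: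
  assumes t: "t > 0" and z: "Re z > 0"
  shows "ln_frac s (of_real t * z) = of_real (t powr (-2 * s)) * ln_frac s z"
proof -
  have d: "ln_diff2 (of_real t * z) (t * h) = ln_diff2 z h" for h
  proof -
    have "z + \<i> * of_real h \<noteq> 0" "z - \<i> * of_real h \<noteq> 0" "z \<noteq> 0"
      using norm_ge_right_half_plane[of z h] z by fastforce+
    moreover have "of_real t * z + \<i> * of_real (t * h) = of_real t * (z + \<i> * of_real h)"
      "of_real t * z - \<i> * of_real (t * h) = of_real t * (z - \<i> * of_real h)"
      by (simp_all add: algebra_simps)
    ultimately show ?thesis
      unfolding ln_diff2_def using t by (simp add: Ln_times_of_real del: of_real_mult)
  qed
  have "ln_frac s (of_real t * z) =
      t *\<^sub>R (\<integral>h. frac_kernel s (t * h) *\<^sub>R ln_diff2 (of_real t * z) (t * h) \<partial>lborel)"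
    unfolding ln_frac_def using t
    by (subst lborel_integral_real_affine[where c = t and t = 0]) auto
  also have "\<dots> = t *\<^sub>R (\<integral>h. t powr (-1 - 2 * s) *\<^sub>R (frac_kernel s h *\<^sub>R ln_diff2 z h) \<partial>lborel)"
    by (simp only: d frac_kernel_scale[OF t] scaleR_scaleR)
  also have "\<dots> = (t * t powr (-1 - 2 * s)) *\<^sub>R ln_frac s z"
    unfolding ln_frac_def integral_scaleR_right by simp
  also have "t * t powr (-1 - 2 * s) = t powr (-2 * s)"
    using t by (simp add: powr_mult_base)
  finally show ?thesis by (simp add: scaleR_conv_of_real)
qed

text \<open>On the positive reals the identity is the scaling law; both sides are holomorphic
  on the right half plane.\<close>

lemma ln_frac_eq:
  assumes s: "0 < s" "s < 1" and z: "Re z > 0"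
  shows "ln_frac s z = ln_frac s 1 * z powr of_real (-2 * s)"
proof -
  let ?U = "complex_of_real ` {0<..}"
  have "ln_frac s z - ln_frac s 1 * z powr of_real (-2 * s) = 0"
  proof (rule analytic_continuation[where S = "{z. Re z > 0}" and U = ?U and \<xi> = 1
        and f = "\<lambda>z. ln_frac s z - ln_frac s 1 * z powr of_real (-2 * s)"])
    show "(\<lambda>z. ln_frac s z - ln_frac s 1 * z powr of_real (-2 * s)) holomorphic_on {z. Re z > 0}"
      by (intro holomorphic_intros ln_frac_holomorphic s) (auto simp: complex_nonpos_Reals_iff)
    show "open {z. 0 < Re z}" by (rule open_halfspace_Re_gt)
    show "connected {z. 0 < Re z}" by (intro convex_connected convex_halfspace_Re_gt)
    show "(1::complex) islimpt ?U"
      unfolding islimpt_approachable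
    proof (intro allI impI)
      fix e :: real assume "e > 0"
      then show "\<exists>x'\<in>?U. x' \<noteq> 1 \<and> dist x' 1 < e"
        by (intro bexI[of _ "of_real (1 + e / 2)"] image_eqI[of _ _ "1 + e / 2"])
          (auto simp: dist_norm)
    qed
    show "ln_frac s w - ln_frac s 1 * w powr of_real (-2 * s) = 0" if w: "w \<in> ?U" for w
    proof -
      obtain t where t: "t > 0" "w = of_real t" using w by auto
      show ?thesis
        using ln_frac_scale[of t 1 s] t powr_of_real[of t "-2 * s"] by simp
    qed
  qed (use z in auto)
  then show ?thesis by simp
qed

definition ln_frac_const :: "real \<Rightarrow> real" where
  "ln_frac_const s = (\<integral>h. frac_kernel s h * ln (1 + h\<^sup>2) \<partial>lborel)"

lemma ln_diff2_1: "ln_diff2 1 h = of_real (ln (1 + h\<^sup>2))"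
proof -
  have "Ln (1 - \<i> * of_real h) = cnj (Ln (1 + \<i> * of_real h))"
    by (subst cnj_Ln) (auto simp: complex_nonpos_Reals_iff)
  then have "ln_diff2 1 h = of_real (2 * Re (Ln (1 + \<i> * of_real h)))"
    by (simp add: ln_diff2_def complex_add_cnj)
  also have "Re (Ln (1 + \<i> * of_real h)) = ln (sqrt (1 + h\<^sup>2))"
    by (subst Re_Ln) (auto simp: complex_eq_iff cmod_def)
  also have "\<dots> = ln (1 + h\<^sup>2) / 2" by (subst ln_sqrt) (auto simp: add_pos_nonneg)
  finally show ?thesis by simp
qed

lemma ln_frac_1: "ln_frac s 1 = of_real (ln_frac_const s)"
  unfolding ln_frac_def ln_frac_const_def ln_diff2_1 integral_complex_of_real[symmetric]
  by (simp add: scaleR_conv_of_real)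

text \<open>The sign matters later: with it the prescribed W' is negative on (0, 1), which yields W
  > 0 on (-1, 1). A zero integral of this nonnegative integrand would make it vanish almost
  everywhere, which fails on (0, 1).\<close>

lemma ln_frac_const_pos:
  assumes s: "0 < s" "s < 1"
  shows "ln_frac_const s > 0"
proof -
  have int: "integrable lborel (\<lambda>h. frac_kernel s h * ln (1 + h\<^sup>2))"
    using integrable_Re[OF integrable_ln_diff2[OF s, of 1]] by (simp add: ln_diff2_1)
  have nonneg: "0 \<le> frac_kernel s h * ln (1 + h\<^sup>2)" for h
    by (simp add: frac_kernel_nonneg)
  have "ln_frac_const s \<noteq> 0"
  proof
    assume "ln_frac_const s = 0"
    then have "AE h in lborel. frac_kernel s h * ln (1 + h\<^sup>2) = 0"
      using nonneg int by (simp add: ln_frac_const_def integral_nonneg_eq_0_iff_AE)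
    then have "AE h in lborel. h \<notin> {0<..<1::real}"
    proof eventually_elim
      fix h :: real assume "frac_kernel s h * ln (1 + h\<^sup>2) = 0"
      moreover have "ln (1 + h\<^sup>2) > 0" if "h > 0" using that by (intro ln_gt_zero) simp
      ultimately show "h \<notin> {0<..<1}" by (auto simp: frac_kernel_def)
    qed
    then have "emeasure lborel {0<..<1::real} = 0"
      by (subst (asm) AE_iff_measurable[of "{0<..<1}"]) auto
    then show False by simp
  qed
  moreover have "0 \<le> ln_frac_const s"
    using nonneg by (simp add: ln_frac_const_def)
  ultimately show ?thesis by simp
qed

section \<open>Imaginary parts: the arctangent profiles\<close>

lemma Im_Ln_right_half_plane:
  assumes "l > 0"
  shows "Im (Ln (Complex l y)) = arctan (y / l)"
  using assms arg_conv_arctan[of "Complex l y"] by (subst Arg_eq_Im_Ln[symmetric]) (auto simp: complex_eq_iff)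

definition arctan_diff2 :: "real \<Rightarrow> real \<Rightarrow> real \<Rightarrow> real" where
  "arctan_diff2 l x h = arctan ((x + h) / l) + arctan ((x - h) / l) - 2 * arctan (x / l)"

lemma arctan_diff2_conv_ln_diff2:
  assumes "l > 0"
  shows "arctan_diff2 l x h = Im (ln_diff2 (Complex l x) h)"
proof -
  have "Complex l x + \<i> * of_real h = Complex l (x + h)" "Complex l x - \<i> * of_real h = Complex l (x - h)"
    by (auto simp: complex_eq_iff)
  then show ?thesis
    by (simp add: ln_diff2_def arctan_diff2_def Im_Ln_right_half_plane assms)
qed

lemma integral_arctan_diff2:
  assumes s: "0 < s" "s < 1" and l: "l > 0"
  shows "integrable lborel (\<lambda>h. frac_kernel s h * arctan_diff2 l x h)"
    and "(\<integral>h. frac_kernel s h * arctan_diff2 l x h \<partial>lborel)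
          = ln_frac_const s * Im (Complex l x powr of_real (-2 * s))"
proof -
  have z: "Re (Complex l x) > 0" using l by simp
  have eq: "frac_kernel s h * arctan_diff2 l x h = Im (frac_kernel s h *\<^sub>R ln_diff2 (Complex l x) h)" for h
    using arctan_diff2_conv_ln_diff2[OF l] by simp
  show "integrable lborel (\<lambda>h. frac_kernel s h * arctan_diff2 l x h)"
    unfolding eq by (intro integrable_Im integrable_ln_diff2 s z)
  have "(\<integral>h. frac_kernel s h * arctan_diff2 l x h \<partial>lborel) = Im (ln_frac s (Complex l x))"
    unfolding eq ln_frac_def by (rule integral_Im) (intro integrable_ln_diff2 s z)
  then show "(\<integral>h. frac_kernel s h * arctan_diff2 l x h \<partial>lborel)
      = ln_frac_const s * Im (Complex l x powr of_real (-2 * s))"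
    using ln_frac_eq[OF s z] by (simp add: ln_frac_1)
qed

text \<open>Uniform in the scale: for \<open>l >= 1\<close> one majorant serves all profiles, which
  later allows the sum over scales to be exchanged with the integral.\<close>

lemma abs_arctan_diff2_le:
  assumes "l \<ge> 1"
  shows "\<bar>arctan_diff2 l x h\<bar> \<le> 2 * h\<^sup>2" "\<bar>arctan_diff2 l x h\<bar> \<le> 2 * pi"
proof -
  have "\<bar>arctan_diff2 l x h\<bar> \<le> norm (ln_diff2 (Complex l x) h)"
    using assms abs_Im_le_cmod by (subst arctan_diff2_conv_ln_diff2) auto
  also have "\<dots> \<le> 2 * h\<^sup>2 / l\<^sup>2" using norm_ln_diff2_le[of "Complex l x" h] assms by simp
  also have "\<dots> \<le> 2 * h\<^sup>2 / 1" using assms by (intro divide_left_mono) auto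
  finally show "\<bar>arctan_diff2 l x h\<bar> \<le> 2 * h\<^sup>2" by simp
  show "\<bar>arctan_diff2 l x h\<bar> \<le> 2 * pi"
    using arctan_bounded[of "(x + h) / l"] arctan_bounded[of "(x - h) / l"] arctan_bounded[of "x / l"]
    unfolding arctan_diff2_def by linarith
qed

section \<open>Mixtures of arctangent profiles\<close>

lemma norm_powr_of_real:
  fixes z :: complex
  assumes "z \<noteq> 0"
  shows "norm (z powr of_real a) = norm z powr a"
  using assms by (simp add: powr_def norm_exp_eq_Re)

lemma norm_Complex_powr_le:
  assumes "l \<ge> 1" "a \<ge> 0"
  shows "norm (Complex l x powr of_real (-a)) \<le> sqrt (1 + x\<^sup>2) powr (-a)"
proof -
  have "Complex l x \<noteq> 0" using assms by (auto simp: complex_eq_iff)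
  then have "norm (Complex l x powr of_real (-a)) = sqrt (l\<^sup>2 + x\<^sup>2) powr (-a)"
    by (subst norm_powr_of_real) (auto simp: complex_norm)
  also have "\<dots> \<le> sqrt (1 + x\<^sup>2) powr (-a)"
    using assms by (intro powr_mono2') (auto simp: add_pos_nonneg)
  finally show ?thesis .
qed

lemma sqrt_powr_minus_le_1:
  fixes x a :: real
  assumes "a \<ge> 0"
  shows "sqrt (1 + x\<^sup>2) powr (-a) \<le> 1"
  using assms powr_mono2'[of "-a" 1 "sqrt (1 + x\<^sup>2)"] by simp

text \<open>With \<open>cpow_Im\<close>, one family for everything that is needed: exponent 1 gives
  the Poisson kernel, the derivative of the arctangent, and \<open>2 * s\<close> its fractional
  Laplacian up to a constant. Differentiation in \<open>x\<close> raises the exponent by one and,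
  through the factor \<open>\<i>\<close>, swaps real and imaginary part.\<close>

definition cpow_Re :: "real \<Rightarrow> real \<Rightarrow> real \<Rightarrow> real" where
  "cpow_Re a l x = Re (Complex l x powr of_real (-a))"

definition cpow_Im :: "real \<Rightarrow> real \<Rightarrow> real \<Rightarrow> real" where
  "cpow_Im a l x = Im (Complex l x powr of_real (-a))"

lemma DERIV_Complex_powr:
  assumes "l > 0"
  shows "(cpow_Re a l has_real_derivative
            a * cpow_Im (a + 1) l x) (at x)"
    and "(cpow_Im a l has_real_derivative
            - a * cpow_Re (a + 1) l x) (at x)"
proof -
  have eq: "Complex l x = of_real l + \<i> * of_real x" for x by (simp add: complex_eq_iff)
  have nz: "of_real l + \<i> * of_real x \<notin> \<real>\<^sub>\<le>\<^sub>0"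
    using assms by (auto simp: complex_nonpos_Reals_iff)
  have "((\<lambda>w. (of_real l + \<i> * w) powr of_real (-a)) has_field_derivative
      of_real (-a) * (of_real l + \<i> * of_real x) powr (of_real (-a) - 1) * \<i>) (at (of_real x))"
  proof (rule DERIV_chain2[where f = "\<lambda>z. z powr of_real (-a)"])
    show "((\<lambda>z. z powr of_real (-a)) has_field_derivative
        of_real (-a) * (of_real l + \<i> * of_real x) powr (of_real (-a) - 1)) (at (of_real l + \<i> * of_real x))"
      by (rule has_field_derivative_powr[OF nz])
    show "((\<lambda>w. of_real l + \<i> * w) has_field_derivative \<i>) (at (of_real x))"
      by (auto intro!: derivative_eq_intros)
  qed
  moreover have "complex_of_real (-a) - 1 = of_real (-(a + 1))" by simp
  ultimately have "((\<lambda>w. (of_real l + \<i> * w) powr of_real (-a)) has_field_derivative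
      - of_real a * \<i> * (of_real l + \<i> * of_real x) powr of_real (-(a + 1))) (at (of_real x))"
    by (simp only: of_real_minus mult_ac)
  from has_vector_derivative_real_field[OF this]
  have d: "((\<lambda>x. Complex l x powr of_real (-a)) has_vector_derivative
      - of_real a * \<i> * Complex l x powr of_real (-(a + 1))) (at x)"
    unfolding eq .
  show "(cpow_Re a l has_real_derivative
            a * cpow_Im (a + 1) l x) (at x)"
    using bounded_linear.has_vector_derivative[OF bounded_linear_Re d]
    by (simp add: cpow_Re_def[abs_def] cpow_Im_def has_real_derivative_iff_has_vector_derivative)
  show "(cpow_Im a l has_real_derivative
            - a * cpow_Re (a + 1) l x) (at x)"
    using bounded_linear.has_vector_derivative[OF bounded_linear_Im d]
    by (simp add: cpow_Im_def[abs_def] cpow_Re_def has_real_derivative_iff_has_vector_derivative)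
qed

lemma cpow_parity:
  assumes "l > 0"
  shows "cpow_Re a l (-x) = cpow_Re a l x" "cpow_Im a l (-x) = - cpow_Im a l x"
proof -
  have "Complex l (-x) = cnj (Complex l x)" by (simp add: complex_eq_iff)
  then have "Complex l (-x) powr of_real (-a) = cnj (Complex l x powr of_real (-a))"
    using assms by (simp add: cnj_powr complex_nonpos_Reals_iff)
  then show "cpow_Re a l (-x) = cpow_Re a l x" "cpow_Im a l (-x) = - cpow_Im a l x"
    by (simp_all only: cpow_Re_def cpow_Im_def cnj.sel)
qed

lemma cpow_Re_1:
  assumes "l > 0"
  shows "cpow_Re 1 l x = l / (l\<^sup>2 + x\<^sup>2)"
  using assms by (simp add: cpow_Re_def powr_minus complex_eq_iff)

text \<open>The argument of the power is \<open>- a * arctan (x / l)\<close>, and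
  \<open>a < 2\<close> keeps \<open>a * arctan (x / l)\<close> inside (0, pi). For
  \<open>a = 2 * s\<close> this is the condition \<open>s < 1\<close>.\<close>

lemma cpow_Im_neg:
  assumes "l > 0" "0 < a" "a < 2" "x > 0"
  shows "cpow_Im a l x < 0"
proof -
  let ?t = "arctan (x / l)"
  have t: "0 < ?t" "?t < pi / 2" using assms arctan_ubound by auto
  have nz: "Complex l x \<noteq> 0" using assms by (auto simp: complex_eq_iff)
  have "cpow_Im a l x = exp (- a * ln (norm (Complex l x))) * sin (- (a * ?t))"
    using nz assms by (simp add: cpow_Im_def powr_def Im_exp Im_Ln_right_half_plane Re_Ln)
  moreover have "a * ?t < 2 * (pi / 2)"
    using assms t by (intro mult_strict_mono) auto
  then have "sin (a * ?t) > 0" using t assms by (intro sin_gt_zero) auto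
  ultimately show ?thesis by simp
qed

text \<open>Total weight 1 makes the mixture a probability average: a bound common to all profiles
  is a bound for the mixture, and the limits 1 and -1 are inherited. Scales at least 1 make the
  bounds on the profiles uniform.\<close>

locale arctan_mixture =
  fixes w l :: "nat \<Rightarrow> real"
  assumes w_pos: "\<And>j. w j > 0" and w_sums: "w sums 1" and l_ge_1: "\<And>j. l j \<ge> 1"
begin

definition u :: "real \<Rightarrow> real" where
  "u x = 2 / pi * (\<Sum>j. w j * arctan (x / l j))"

definition mix_Re :: "real \<Rightarrow> real \<Rightarrow> real" where
  "mix_Re a x = (\<Sum>j. w j * cpow_Re a (l j) x)"

definition mix_Im :: "real \<Rightarrow> real \<Rightarrow> real" where
  "mix_Im a x = (\<Sum>j. w j * cpow_Im a (l j) x)"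

lemma w_summable: "summable w" using w_sums by (simp add: sums_iff)
lemma w_suminf: "suminf w = 1" using w_sums by (simp add: sums_iff)
lemma l_pos: "l j > 0" using l_ge_1[of j] by linarith
lemma w_nonneg: "0 \<le> w j" using w_pos[of j] by linarith

lemma weighted_summable:
  assumes "\<And>j. \<bar>f j\<bar> \<le> B"
  shows "summable (\<lambda>j. w j * f j)"
proof (rule summable_comparison_test')
  show "summable (\<lambda>j. w j * B)" by (intro summable_mult2 w_summable)
  show "norm (w j * f j) \<le> w j * B" for j
    using assms[of j] w_nonneg[of j] by (simp add: abs_mult mult_left_mono)
qed

lemma weighted_suminf_abs_le:
  assumes "\<And>j. \<bar>f j\<bar> \<le> B"
  shows "\<bar>\<Sum>j. w j * f j\<bar> \<le> B"
proof -
  have s: "summable (\<lambda>j. \<bar>w j * f j\<bar>)"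
  proof (rule summable_comparison_test')
    show "summable (\<lambda>j. w j * B)" by (intro summable_mult2 w_summable)
    show "norm \<bar>w j * f j\<bar> \<le> w j * B" for j
      using assms[of j] w_nonneg[of j] by (simp add: abs_mult mult_left_mono)
  qed
  have "\<bar>\<Sum>j. w j * f j\<bar> \<le> (\<Sum>j. \<bar>w j * f j\<bar>)" by (rule summable_rabs[OF s])
  also have "\<dots> \<le> (\<Sum>j. w j * B)"
    using assms w_nonneg s by (intro suminf_le summable_mult2 w_summable)
      (auto simp: abs_mult intro: mult_left_mono)
  also have "\<dots> = B" using suminf_mult2[OF w_summable, of B] w_suminf by simp
  finally show ?thesis .
qed

lemma weighted_DERIV:
  assumes d: "\<And>j x. (f j has_real_derivative f' j x) (at x)"
    and b: "\<And>j x. \<bar>f j x\<bar> \<le> B" and b': "\<And>j x. \<bar>f' j x\<bar> \<le> B'"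
  shows "((\<lambda>x. \<Sum>j. w j * f j x) has_real_derivative (\<Sum>j. w j * f' j x)) (at x)"
proof (rule has_field_derivative_series'(2)[of UNIV "\<lambda>j x. w j * f j x" "\<lambda>j x. w j * f' j x" 0])
  show "((\<lambda>x. w n * f n x) has_real_derivative w n * f' n y) (at y within UNIV)" for n y
    using d by (auto intro: DERIV_cmult)
  show "uniformly_convergent_on UNIV (\<lambda>n x. \<Sum>i<n. w i * f' i x)"
  proof (rule Weierstrass_m_test')
    show "norm (w n * f' n x) \<le> w n * B'" for n x
      using b'[of n x] w_nonneg[of n] by (simp add: abs_mult mult_left_mono)
    show "summable (\<lambda>n. w n * B')" by (intro summable_mult2 w_summable)
  qed
  show "summable (\<lambda>n. w n * f n 0)" using b by (rule weighted_summable)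
qed auto

lemma abs_Re_Im_powr_le:
  assumes "a \<ge> 0"
  shows "\<bar>cpow_Re a (l j) x\<bar> \<le> sqrt (1 + x\<^sup>2) powr (-a)"
    and "\<bar>cpow_Im a (l j) x\<bar> \<le> sqrt (1 + x\<^sup>2) powr (-a)"
    and "\<bar>cpow_Re a (l j) x\<bar> \<le> 1"
    and "\<bar>cpow_Im a (l j) x\<bar> \<le> 1"
  using norm_Complex_powr_le[OF l_ge_1[of j] assms, of x] sqrt_powr_minus_le_1[OF assms, of x]
    abs_Re_le_cmod[of "Complex (l j) x powr of_real (-a)"]
    abs_Im_le_cmod[of "Complex (l j) x powr of_real (-a)"]
  unfolding cpow_Re_def cpow_Im_def by linarith+

lemma mix_summable:
  assumes "a \<ge> 0"
  shows "summable (\<lambda>j. w j * cpow_Re a (l j) x)" "summable (\<lambda>j. w j * cpow_Im a (l j) x)"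
  by (rule weighted_summable, rule abs_Re_Im_powr_le[OF assms])+

lemma abs_mix_le:
  assumes "a \<ge> 0"
  shows "\<bar>mix_Re a x\<bar> \<le> sqrt (1 + x\<^sup>2) powr (-a)" "\<bar>mix_Im a x\<bar> \<le> sqrt (1 + x\<^sup>2) powr (-a)"
  unfolding mix_Re_def mix_Im_def
  by (intro weighted_suminf_abs_le abs_Re_Im_powr_le assms)+

lemma DERIV_mix:
  assumes "a \<ge> 0"
  shows "(mix_Re a has_real_derivative a * mix_Im (a + 1) x) (at x)"
    and "(mix_Im a has_real_derivative - a * mix_Re (a + 1) x) (at x)"
proof -
  have b: "\<bar>c * r\<bar> \<le> \<bar>c\<bar>" if "\<bar>r\<bar> \<le> 1" for c r :: real
    using that mult_left_mono[of "\<bar>r\<bar>" 1 "\<bar>c\<bar>"] by (simp add: abs_mult)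
  have a1: "a + 1 \<ge> 0" using assms by simp
  note 1 = mix_summable(2)[OF a1, of x] and 2 = mix_summable(1)[OF a1, of x]
  have "((\<lambda>x. \<Sum>j. w j * cpow_Re a (l j) x) has_real_derivative
      (\<Sum>j. w j * (a * cpow_Im (a + 1) (l j) x))) (at x)"
    by (rule weighted_DERIV) (rule DERIV_Complex_powr[OF l_pos] abs_Re_Im_powr_le[OF assms] b
      abs_Re_Im_powr_le[OF a1])+
  then show "(mix_Re a has_real_derivative a * mix_Im (a + 1) x) (at x)"
    using suminf_mult[OF 1, where c = a] by (simp add: mix_Re_def[abs_def] mix_Im_def mult.left_commute)
  have "((\<lambda>x. \<Sum>j. w j * cpow_Im a (l j) x) has_real_derivative
      (\<Sum>j. w j * (- a * cpow_Re (a + 1) (l j) x))) (at x)"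
    by (rule weighted_DERIV) (rule DERIV_Complex_powr[OF l_pos] abs_Re_Im_powr_le[OF assms] b
      abs_Re_Im_powr_le[OF a1])+
  then show "(mix_Im a has_real_derivative - a * mix_Re (a + 1) x) (at x)"
    using suminf_mult[OF 2, where c = "- a"] by (simp add: mix_Im_def[abs_def] mix_Re_def mult.left_commute)
qed

lemma mix_parity:
  assumes "a \<ge> 0"
  shows "mix_Re a (-x) = mix_Re a x" "mix_Im a (-x) = - mix_Im a x"
proof -
  show "mix_Re a (-x) = mix_Re a x"
    unfolding mix_Re_def by (simp add: cpow_parity[OF l_pos])
  show "mix_Im a (-x) = - mix_Im a x"
    using suminf_minus[OF mix_summable(2)[OF assms, of x]]
    unfolding mix_Im_def by (simp add: cpow_parity[OF l_pos])
qed

lemma mix_Im_neg: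
  assumes "0 < a" "a < 2" "x > 0"
  shows "mix_Im a x < 0"
proof -
  have "0 < (\<Sum>j. w j * - cpow_Im a (l j) x)"
  proof (rule suminf_pos)
    show "summable (\<lambda>j. w j * - cpow_Im a (l j) x)"
      using summable_minus[OF mix_summable(2)[of a x]] assms by simp
    show "0 < w j * - cpow_Im a (l j) x" for j
      using cpow_Im_neg[OF l_pos assms] w_pos by (intro mult_pos_pos) auto
  qed
  also have "\<dots> = (\<Sum>j. - (w j * cpow_Im a (l j) x))" by simp
  also have "\<dots> = - mix_Im a x"
    unfolding mix_Im_def using assms by (intro suminf_minus mix_summable) auto
  finally show ?thesis by simp
qed

end

text \<open>Meant for \<open>y = l / x\<close>: then the left side is
  \<open>x * l / (l\<^sup>2 + x\<^sup>2)\<close>, that is, \<open>x\<close> times the slope of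
  \<open>arctan (x / l)\<close>, while \<open>arctan y\<close> is its distance from
  \<open>pi / 2\<close>.\<close>

lemma arctan_lower_bound:
  fixes y :: real
  assumes "y \<ge> 0"
  shows "y / (1 + y\<^sup>2) \<le> arctan y"
proof -
  let ?f = "\<lambda>y::real. arctan y - y / (1 + y\<^sup>2)"
  have pos: "1 + t\<^sup>2 > 0" for t :: real by (simp add: add_pos_nonneg)
  have "?f 0 \<le> ?f y"
  proof (rule DERIV_nonneg_imp_nondecreasing[OF assms])
    fix t :: real
    have "(?f has_real_derivative 1 / (1 + t\<^sup>2) - (1 * (1 + t\<^sup>2) - t * (2 * t)) / ((1 + t\<^sup>2) * (1 + t\<^sup>2))) (at t)"
      using pos[of t] by (auto intro!: derivative_eq_intros simp: inverse_eq_divide)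
    moreover have "1 / (1 + t\<^sup>2) - (1 * (1 + t\<^sup>2) - t * (2 * t)) / ((1 + t\<^sup>2) * (1 + t\<^sup>2))
        = 2 * t\<^sup>2 / (1 + t\<^sup>2)\<^sup>2"
      using pos[of t] by (simp add: divide_simps power2_eq_square)
    ultimately have "(?f has_real_derivative 2 * t\<^sup>2 / (1 + t\<^sup>2)\<^sup>2) (at t)" by simp
    then show "\<exists>d. (?f has_real_derivative d) (at t) \<and> 0 \<le> d" by auto
  qed
  then show ?thesis by simp
qed

lemma arctan_upper_bound:
  fixes y :: real
  assumes "y \<ge> 0"
  shows "arctan y \<le> y"
proof -
  let ?f = "\<lambda>y::real. y - arctan y"
  have "?f 0 \<le> ?f y"
  proof (rule DERIV_nonneg_imp_nondecreasing[OF assms])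
    fix t :: real
    have "(?f has_real_derivative 1 - inverse (1 + t\<^sup>2)) (at t)"
      by (auto intro!: derivative_eq_intros)
    moreover have "inverse (1 + t\<^sup>2) \<le> 1" by (intro inverse_le_1_iff[THEN iffD2]) auto
    ultimately show "\<exists>d. (?f has_real_derivative d) (at t) \<and> 0 \<le> d" by force
  qed
  then show ?thesis by simp
qed

lemma cpow_Re_polar:
  assumes "l > 0"
  shows "cpow_Re a l x = sqrt (l\<^sup>2 + x\<^sup>2) powr (-a) * cos (a * arctan (x / l))"
proof -
  have nz: "Complex l x \<noteq> 0" using assms by (auto simp: complex_eq_iff)
  have "sqrt (l\<^sup>2 + x\<^sup>2) \<noteq> 0" using nz by (metis complex_norm norm_eq_zero)
  then show ?thesis
    using nz assms
    by (simp add: cpow_Re_def powr_def Re_exp Im_Ln_right_half_plane Re_Ln complex_norm)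
qed

lemma cpow_limit:
  assumes l: "l > 0"
  shows "((\<lambda>x. x powr a * cpow_Re a l x) \<longlongrightarrow> cos (a * (pi / 2))) at_top"
proof -
  have 1: "((\<lambda>x. x / sqrt (l\<^sup>2 + x\<^sup>2)) \<longlongrightarrow> 1) at_top" using l by real_asymp
  have "LIM x at_top. x / l :> at_top" using l by real_asymp
  then have 2: "((\<lambda>x. arctan (x / l)) \<longlongrightarrow> pi / 2) at_top"
    by (rule filterlim_compose[OF tendsto_arctan_at_top])
  have "((\<lambda>x. (x / sqrt (l\<^sup>2 + x\<^sup>2)) powr a * cos (a * arctan (x / l))) \<longlongrightarrow> 1 powr a * cos (a * (pi / 2))) at_top"
    by (intro tendsto_intros 1 2) auto
  moreover have "\<forall>\<^sub>F x in at_top. (x / sqrt (l\<^sup>2 + x\<^sup>2)) powr a * cos (a * arctan (x / l)) = x powr a * cpow_Re a l x"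
    using eventually_gt_at_top[of 0]
    by eventually_elim (simp add: cpow_Re_polar[OF l] powr_divide powr_minus field_simps)
  ultimately show ?thesis
    by (subst (asm) filterlim_cong[OF refl refl]) auto
qed

context arctan_mixture
begin

section \<open>Monotonicity, tail and limits of the mixture\<close>

lemma abs_arctan_le: "\<bar>arctan y\<bar> \<le> pi / 2"
  using arctan_bounded[of y] by linarith

lemma u_summable: "summable (\<lambda>j. w j * arctan (x / l j))"
  by (rule weighted_summable) (rule abs_arctan_le)

lemma DERIV_u: "(u has_real_derivative 2 / pi * mix_Re 1 x) (at x)"
proof -
  have "((\<lambda>x. \<Sum>j. w j * arctan (x / l j)) has_real_derivative (\<Sum>j. w j * cpow_Re 1 (l j) x)) (at x)"
  proof (rule weighted_DERIV)
    fix j y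
    show "((\<lambda>x. arctan (x / l j)) has_real_derivative cpow_Re 1 (l j) y) (at y)"
      using l_pos[of j] unfolding cpow_Re_1[OF l_pos]
      by (auto intro!: derivative_eq_intros simp: divide_simps power2_eq_square)
    show "\<bar>cpow_Re 1 (l j) y\<bar> \<le> 1" by (rule abs_Re_Im_powr_le) simp
  qed (rule abs_arctan_le)
  then show ?thesis
    unfolding u_def[abs_def] mix_Re_def by (rule DERIV_cmult)
qed

text \<open>All terms are positive, so any single scale gives a lower bound; \<open>j\<close> will
  be fitted to the size of \<open>x\<close>.\<close>

lemma mix_Re_1_ge: "w j * (l j / ((l j)\<^sup>2 + x\<^sup>2)) \<le> mix_Re 1 x"
proof -
  have "(\<Sum>i\<in>{j}. w i * cpow_Re 1 (l i) x) \<le> (\<Sum>i. w i * cpow_Re 1 (l i) x)"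
    using w_nonneg l_pos by (intro sum_le_suminf mix_summable) (auto simp: cpow_Re_1 less_imp_le)
  then show ?thesis by (simp add: mix_Re_def cpow_Re_1[OF l_pos])
qed

lemma mix_Re_1_pos: "mix_Re 1 x > 0"
proof -
  have "0 < w 0 * (l 0 / ((l 0)\<^sup>2 + x\<^sup>2))"
    using w_pos[of 0] l_pos[of 0] by (intro mult_pos_pos divide_pos_pos) (auto simp: add_pos_nonneg)
  also have "\<dots> \<le> mix_Re 1 x" by (rule mix_Re_1_ge)
  finally show ?thesis .
qed

lemma u_strict_mono: "strict_mono u"
proof (rule strict_monoI)
  fix x y :: real assume "x < y"
  then show "u x < u y"
    using DERIV_u mix_Re_1_pos by (intro DERIV_pos_imp_increasing[of x y u]) (auto intro!: exI conjI)
qed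

lemma isCont_u: "isCont u x" using DERIV_u DERIV_isCont by blast

lemma continuous_on_u: "continuous_on A u"
  using isCont_u by (simp add: continuous_at_imp_continuous_on)

lemma u_odd: "u (-x) = - u x"
  using suminf_minus[OF u_summable[of x]] by (simp add: u_def arctan_minus)

text \<open>Since \<open>arctan (x / l)\<close> and \<open>arctan (l / x)\<close> add up to
  \<open>pi / 2\<close>, the tail is itself a series of positive terms and can be estimated scale by
  scale.\<close>

lemma one_minus_u:
  assumes "x > 0"
  shows "1 - u x = 2 / pi * (\<Sum>j. w j * arctan (l j / x))"
proof -
  have eq: "w j * arctan (l j / x) = w j * (pi / 2) - w j * arctan (x / l j)" for j
  proof -
    have "arctan (l j / x) = pi / 2 - arctan (x / l j)"
      using arctan_inverse[of "x / l j"] assms l_pos[of j] by simp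
    then show ?thesis by (simp only: right_diff_distrib)
  qed
  have "(\<Sum>j. w j * arctan (l j / x)) = (\<Sum>j. w j * (pi / 2)) - (\<Sum>j. w j * arctan (x / l j))"
    unfolding eq by (intro suminf_diff[symmetric] u_summable summable_mult2 w_summable)
  also have "(\<Sum>j. w j * (pi / 2)) = pi / 2"
    using suminf_mult2[OF w_summable, of "pi / 2"] w_suminf by simp
  finally show ?thesis by (simp add: u_def right_diff_distrib)
qed

lemma arctan_inverse_summable: "summable (\<lambda>j. w j * arctan (l j / x))"
  by (rule weighted_summable) (rule abs_arctan_le)

lemma one_minus_u_ge:
  assumes "x > 0"
  shows "2 / pi * (w j * arctan (l j / x)) \<le> 1 - u x"
proof -
  have "(\<Sum>i\<in>{j}. w i * arctan (l i / x)) \<le> (\<Sum>i. w i * arctan (l i / x))"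
    using w_nonneg l_pos assms
    by (intro sum_le_suminf arctan_inverse_summable) (auto simp: less_imp_le)
  then show ?thesis unfolding one_minus_u[OF assms] by (intro mult_left_mono) auto
qed

lemma u_bounds: "-1 < u x" "u x < 1"
proof -
  have pos: "u x < 1" if "x > 0" for x
  proof -
    have "0 < 2 / pi * (w 0 * arctan (l 0 / x))"
      using w_pos[of 0] l_pos[of 0] that by simp
    then show ?thesis using one_minus_u_ge[OF that, of 0] by linarith
  qed
  have lt: "u x < 1" for x
    using pos[of "max x 1"] strict_mono_leD[OF u_strict_mono, of x "max x 1"] by linarith
  then show "-1 < u x" "u x < 1" using u_odd[of x] lt[of "-x"] by auto
qed

text \<open>A termwise comparison that turns every upper bound on the tail into one on the slope;
  read backwards, it turns lower bounds on the slope into lower bounds on the tail.\<close>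

lemma x_deriv_u_le:
  assumes x: "x > 0"
  shows "x * (2 / pi * mix_Re 1 x) \<le> 1 - u x"
proof -
  have "x * mix_Re 1 x = (\<Sum>j. x * (w j * cpow_Re 1 (l j) x))"
    unfolding mix_Re_def by (rule suminf_mult[symmetric]) (rule mix_summable, simp)
  also have "\<dots> \<le> (\<Sum>j. w j * arctan (l j / x))"
  proof (rule suminf_le)
    fix j
    have "x * cpow_Re 1 (l j) x = (l j / x) / (1 + (l j / x)\<^sup>2)"
      using x l_pos[of j] by (simp add: cpow_Re_1 divide_simps power2_eq_square)
    also have "\<dots> \<le> arctan (l j / x)"
      using x l_pos[of j] by (intro arctan_lower_bound) auto
    finally have "w j * (x * cpow_Re 1 (l j) x) \<le> w j * arctan (l j / x)"
      using w_nonneg[of j] by (rule mult_left_mono)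
    then show "x * (w j * cpow_Re 1 (l j) x) \<le> w j * arctan (l j / x)"
      by (simp only: mult.left_commute)
  qed (auto intro!: summable_mult mix_summable arctan_inverse_summable)
  finally show ?thesis
    unfolding one_minus_u[OF x] by (simp add: mult_left_mono divide_right_mono mult.left_commute)
qed

text \<open>Scales from index \<open>n\<close> on are bounded by their full weight through
  \<open>arctan <= pi / 2\<close>, the earlier ones by \<open>arctan y <= y\<close>. The bound is
  efficient when \<open>n\<close> separates the scales above \<open>x\<close> from those
  below.\<close>

lemma one_minus_u_le:
  assumes x: "x > 0"
  shows "1 - u x \<le> (\<Sum>i. w (i + n)) + (\<Sum>i<n. w i * l i) / x"
proof -
  let ?f = "\<lambda>i. w i * arctan (l i / x)"
  have tail: "(\<Sum>i. ?f (i + n)) \<le> (\<Sum>i. w (i + n) * (pi / 2))"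
    using w_nonneg arctan_ubound summable_ignore_initial_segment[OF arctan_inverse_summable]
      summable_ignore_initial_segment[OF w_summable]
    by (intro suminf_le mult_left_mono summable_mult2) (auto simp: less_imp_le)
  have head: "(\<Sum>i<n. ?f i) \<le> (\<Sum>i<n. w i * l i / x)"
  proof (rule sum_mono)
    fix i
    have "w i * arctan (l i / x) \<le> w i * (l i / x)"
      using x l_pos[of i] w_nonneg by (intro mult_left_mono arctan_upper_bound) auto
    then show "?f i \<le> w i * l i / x" by simp
  qed
  have h0: "0 \<le> (\<Sum>i<n. w i * l i / x)"
    using x w_nonneg l_pos by (intro sum_nonneg divide_nonneg_nonneg mult_nonneg_nonneg) (auto simp: less_imp_le)
  have "1 - u x = 2 / pi * ((\<Sum>i. ?f (i + n)) + (\<Sum>i<n. ?f i))"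
    unfolding one_minus_u[OF x] by (subst suminf_split_initial_segment[OF arctan_inverse_summable, of x n]) simp
  also have "\<dots> \<le> 2 / pi * ((\<Sum>i. w (i + n) * (pi / 2)) + (\<Sum>i<n. w i * l i / x))"
    using tail head by (intro mult_left_mono add_mono) auto
  also have "(\<Sum>i. w (i + n) * (pi / 2)) = (\<Sum>i. w (i + n)) * (pi / 2)"
    by (rule suminf_mult2[symmetric]) (simp add: summable_iff_shift w_summable)
  also have "2 / pi * ((\<Sum>i. w (i + n)) * (pi / 2) + (\<Sum>i<n. w i * l i / x))
      = (\<Sum>i. w (i + n)) + 2 / pi * (\<Sum>i<n. w i * l i / x)" by (simp add: algebra_simps)
  also have "2 / pi * (\<Sum>i<n. w i * l i / x) \<le> 1 * (\<Sum>i<n. w i * l i / x)"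
    using h0 pi_gt3 by (intro mult_right_mono) auto
  finally show ?thesis by (simp add: sum_divide_distrib)
qed

lemma tendsto_weighted_suminf:
  assumes lim: "\<And>j. ((\<lambda>x. f j x) \<longlongrightarrow> c) F"
    and bound: "\<forall>\<^sub>F x in F. \<forall>j. \<bar>f j x\<bar> \<le> B" and F: "F \<noteq> bot"
  shows "((\<lambda>x. \<Sum>j. w j * f j x) \<longlongrightarrow> c) F"
proof -
  have "((\<lambda>x. \<Sum>j. w j * f j x) \<longlongrightarrow> (\<Sum>j. w j * c)) F"
  proof (rule tannerys_theorem[THEN conjunct2, THEN conjunct2])
    show "((\<lambda>x. w j * f j x) \<longlongrightarrow> w j * c) F" for j by (intro tendsto_intros lim)
    have "\<forall>\<^sub>F (j, x) in at_top \<times>\<^sub>F F. \<bar>f j x\<bar> \<le> B"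
      using bound by (auto simp: eventually_prod_filter intro!: exI[of _ "\<lambda>_. True"] exI[of _ "\<lambda>x. \<forall>j. \<bar>f j x\<bar> \<le> B"])
    then show "\<forall>\<^sub>F (j, x) in at_top \<times>\<^sub>F F. norm (w j * f j x) \<le> w j * B"
      by eventually_elim (auto simp: abs_mult w_nonneg mult_left_mono)
    show "summable (\<lambda>j. w j * B)" by (intro summable_mult2 w_summable)
  qed (rule F)
  then show ?thesis using suminf_mult2[OF w_summable, of c] w_suminf by simp
qed

lemma u_tendsto_1: "(u \<longlongrightarrow> 1) at_top"
proof -
  have "((\<lambda>x. \<Sum>j. w j * arctan (x / l j)) \<longlongrightarrow> pi / 2) at_top"
  proof (rule tendsto_weighted_suminf)
    fix j
    have "LIM x at_top. x / l j :> at_top" using l_pos[of j] by real_asymp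
    then show "((\<lambda>x. arctan (x / l j)) \<longlongrightarrow> pi / 2) at_top"
      by (rule filterlim_compose[OF tendsto_arctan_at_top])
  qed (auto intro!: always_eventually abs_arctan_le)
  from tendsto_mult[OF tendsto_const[of "2 / pi"] this] show ?thesis
    by (simp add: u_def[abs_def])
qed

lemma u_tendsto_m1: "(u \<longlongrightarrow> -1) at_bot"
proof -
  have "((\<lambda>x. - u (-x)) \<longlongrightarrow> -1) at_bot"
    by (intro tendsto_minus filterlim_compose[OF u_tendsto_1] filterlim_uminus_at_top_at_bot)
  then show ?thesis by (simp add: u_odd)
qed

text \<open>The limit is the same for every scale, and \<open>x powr a * cpow_Re a (l j) x\<close>
  is bounded by 1 uniformly in \<open>j\<close>, so Tannery's theorem applies. Hence the derivative
  of the right-hand side has a clean power law even when \<open>u\<close> oscillates.\<close>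

lemma mix_Re_limit:
  assumes "a \<ge> 0"
  shows "((\<lambda>x. x powr a * mix_Re a x) \<longlongrightarrow> cos (a * (pi / 2))) at_top"
proof -
  have "((\<lambda>x. \<Sum>j. w j * (x powr a * cpow_Re a (l j) x)) \<longlongrightarrow> cos (a * (pi / 2))) at_top"
  proof (rule tendsto_weighted_suminf)
    show "((\<lambda>x. x powr a * cpow_Re a (l j) x) \<longlongrightarrow> cos (a * (pi / 2))) at_top" for j
      by (rule cpow_limit[OF l_pos])
    show "\<forall>\<^sub>F x in at_top. \<forall>j. \<bar>x powr a * cpow_Re a (l j) x\<bar> \<le> 1"
      using eventually_gt_at_top[of 0]
    proof eventually_elim
      case (elim x)
      have "sqrt (1 + x\<^sup>2) powr (-a) \<le> x powr (-a)"
        using elim assms by (intro powr_mono2') (auto intro: real_le_rsqrt)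
      then have "x powr a * \<bar>cpow_Re a (l j) x\<bar> \<le> x powr a * x powr (-a)" for j
        using abs_Re_Im_powr_le(1)[OF assms, of j x] by (intro mult_left_mono) auto
      then show ?case using elim by (auto simp: abs_mult powr_add[symmetric])
    qed
  qed auto
  moreover have "(\<Sum>j. w j * (x powr a * cpow_Re a (l j) x)) = x powr a * mix_Re a x" for x
    unfolding mix_Re_def using suminf_mult[OF mix_summable(1)[OF assms, of x], of "x powr a"]
    by (simp add: mult.left_commute)
  ultimately show ?thesis by simp
qed

lemma sqrt_powr_tendsto_0:
  assumes "a > 0"
  shows "((\<lambda>x::real. sqrt (1 + x\<^sup>2) powr (-a)) \<longlongrightarrow> 0) at_top"
  using assms by real_asymp

lemma mix_tendsto_0:
  assumes "a > 0"
  shows "(mix_Im a \<longlongrightarrow> 0) at_top"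
  using abs_mix_le(2)[of a] assms
  by (intro Lim_null_comparison[OF _ sqrt_powr_tendsto_0[OF assms]]) auto

end

section \<open>The principal value equation\<close>

text \<open>The truncated integral at level \<epsilon> equals the integral of the folded integrand
  \<open>D\<close> over \<open>h > \<epsilon>\<close>. As \<open>D\<close> is integrable, it
  dominates all its truncations, and the limit follows.\<close>

lemma frac_PV_eqI:
  fixes u :: "real \<Rightarrow> real"
  assumes s: "0 < s" and cont: "continuous_on UNIV u" and bd: "\<And>x. \<bar>u x\<bar> \<le> B"
    and int: "integrable lborel (\<lambda>h. frac_kernel s h * (u (x + h) + u (x - h) - 2 * u x))"
    and L: "(\<integral>h. frac_kernel s h * (u (x + h) + u (x - h) - 2 * u x) \<partial>lborel) = L"
  shows "frac_PV_eq s u x L"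
proof -
  have [measurable]: "u \<in> borel_measurable borel"
    using cont by (rule borel_measurable_continuous_onI)
  let ?q = "\<lambda>y. (u y - u x) / \<bar>x - y\<bar> powr (1 + 2 * s)"
  define q where "q \<epsilon> y = indicator {y. \<epsilon> < \<bar>y - x\<bar>} y *\<^sub>R ?q y" for \<epsilon> y
  \<comment> \<open>The sign \<open>c\<close> selects the side of \<open>x\<close>: 1 for the right,
    -1 for the left. Each side is integrable by itself as long as \<epsilon> is positive, because
    \<open>u\<close> is bounded.\<close>
  define k where "k c \<epsilon> h = indicator {\<epsilon><..} h * h powr (-1 - 2 * s) * (u (x + c * h) - u x)" for c \<epsilon> h :: real
  have k_int: "integrable lborel (k c \<epsilon>)" if "\<epsilon> > 0" for c \<epsilon>
  proof (rule Bochner_Integration.integrable_bound)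
    show "integrable lborel (\<lambda>h. 2 * B * (indicator {\<epsilon><..} h * h powr (-1 - 2 * s)))"
      using s that by (intro integrable_mult_right integrable_powr_near_inf) auto
    show "k c \<epsilon> \<in> borel_measurable lborel" unfolding k_def by measurable
    show "AE h in lborel. norm (k c \<epsilon> h) \<le> norm (2 * B * (indicator {\<epsilon><..} h * h powr (-1 - 2 * s)))"
    proof (rule AE_I2)
      fix h
      have "\<bar>u (x + c * h) - u x\<bar> \<le> \<bar>2 * B\<bar>"
        using bd[of "x + c * h"] bd[of x] by linarith
      then have "\<bar>u (x + c * h) - u x\<bar> * (indicator {\<epsilon><..} h * h powr (-1 - 2 * s))
          \<le> \<bar>2 * B\<bar> * (indicator {\<epsilon><..} h * h powr (-1 - 2 * s))"
        by (rule mult_right_mono) simp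
      then show "norm (k c \<epsilon> h) \<le> norm (2 * B * (indicator {\<epsilon><..} h * h powr (-1 - 2 * s)))"
        unfolding k_def by (simp only: real_norm_def abs_mult) (simp add: ac_simps)
    qed
  qed
  \<comment> \<open>The terms \<open>x + 1 * h\<close> and \<open>0 + (-1) * h\<close> are kept
    unsimplified as instances of the affine substitution \<open>t + c * h\<close> for Lebesgue
    measure.\<close>
  have q_eq: "q \<epsilon> (x + 1 * h) = k 1 \<epsilon> h + k (-1) \<epsilon> (0 + (-1) * h)" if "\<epsilon> > 0" for \<epsilon> h
  proof -
    have p: "h powr (-1 - 2 * s) = 1 / h powr (1 + 2 * s)" for h :: real
      using powr_minus_divide[of h "1 + 2 * s"] by simp
    consider "\<bar>h\<bar> \<le> \<epsilon>" | "h > \<epsilon>" | "h < - \<epsilon>" by linarith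
    then show ?thesis using that by cases (auto simp: q_def k_def p)
  qed
  have q_int: "integrable lborel (q \<epsilon>)" if "\<epsilon> > 0" for \<epsilon>
  proof -
    have "integrable lborel (\<lambda>h. q \<epsilon> (x + 1 * h))"
      unfolding q_eq[OF that]
      by (intro Bochner_Integration.integrable_add lborel_integrable_real_affine k_int that) auto
    then show ?thesis by (subst (asm) lborel_integrable_real_affine_iff) auto
  qed
  define D where "D h = frac_kernel s h * (u (x + h) + u (x - h) - 2 * u x)" for h
  have trunc: "frac_trunc s u x \<epsilon> = (\<integral>h. indicator {\<epsilon><..} h * D h \<partial>lborel)" if "\<epsilon> > 0" for \<epsilon>
  proof -
    have "frac_trunc s u x \<epsilon> = (\<integral>y. q \<epsilon> y \<partial>lborel)"
      by (simp add: frac_trunc_def set_lebesgue_integral_def q_def)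
    also have "\<dots> = (\<integral>h. q \<epsilon> (x + 1 * h) \<partial>lborel)"
      by (subst lborel_integral_real_affine[where c = 1 and t = x]) auto
    also have "\<dots> = (\<integral>h. k 1 \<epsilon> h \<partial>lborel) + (\<integral>h. k (-1) \<epsilon> (0 + (-1) * h) \<partial>lborel)"
      unfolding q_eq[OF that]
      by (intro Bochner_Integration.integral_add lborel_integrable_real_affine k_int that) auto
    also have "(\<integral>h. k (-1) \<epsilon> (0 + (-1) * h) \<partial>lborel) = (\<integral>h. k (-1) \<epsilon> h \<partial>lborel)"
      using lborel_integral_real_affine[of "-1" "k (-1) \<epsilon>" 0] by simp
    also have "(\<integral>h. k 1 \<epsilon> h \<partial>lborel) + (\<integral>h. k (-1) \<epsilon> h \<partial>lborel) = (\<integral>h. k 1 \<epsilon> h + k (-1) \<epsilon> h \<partial>lborel)"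
      by (intro Bochner_Integration.integral_add[symmetric] k_int that)
    also have "\<dots> = (\<integral>h. indicator {\<epsilon><..} h * D h \<partial>lborel)"
      using that by (intro Bochner_Integration.integral_cong)
        (auto simp: k_def D_def frac_kernel_def algebra_simps split: split_indicator)
    finally show ?thesis .
  qed
  have D_int: "integrable lborel D" using int by (simp add: D_def[abs_def])
  have "((\<lambda>\<epsilon>. frac_trunc s u x \<epsilon>) \<longlongrightarrow> L) (at_right 0)"
  proof (rule tendsto_at_right_sequentially[where b = 1])
    fix S :: "nat \<Rightarrow> real"
    assume S: "\<And>n. 0 < S n" "S \<longlonglongrightarrow> 0"
    have "(\<lambda>n. \<integral>h. indicator {S n<..} h * D h \<partial>lborel) \<longlonglongrightarrow> (\<integral>h. D h \<partial>lborel)"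
    proof (rule integral_dominated_convergence)
      show "D \<in> borel_measurable lborel" using D_int by (rule borel_measurable_integrable)
      then show "(\<lambda>h. indicator {S n<..} h * D h) \<in> borel_measurable lborel" for n by measurable
      show "integrable lborel (\<lambda>h. norm (D h))" using D_int by (rule integrable_norm)
      show "AE h in lborel. norm (indicator {S n<..} h * D h) \<le> norm (D h)" for n
        by (auto split: split_indicator)
      show "AE h in lborel. (\<lambda>n. indicator {S n<..} h * D h) \<longlonglongrightarrow> D h"
      proof (rule AE_I2)
        fix h
        show "(\<lambda>n. indicator {S n<..} h * D h) \<longlonglongrightarrow> D h"
        proof (cases "h > 0")
          case True
          from order_tendstoD(2)[OF S(2) this]
          have "\<forall>\<^sub>F n in sequentially. indicator {S n<..} h * D h = D h"
            by eventually_elim auto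
          then show ?thesis by (rule tendsto_eventually)
        qed (simp add: D_def frac_kernel_def)
      qed
    qed
    then show "(\<lambda>n. frac_trunc s u x (S n)) \<longlonglongrightarrow> L"
      using L by (simp add: trunc[OF S(1)] D_def)
  qed simp
  moreover have "set_integrable lborel {y. \<epsilon> < \<bar>y - x\<bar>} ?q" if "\<epsilon> > 0" for \<epsilon>
    using q_int[OF that] by (simp add: set_integrable_def q_def[abs_def])
  ultimately show ?thesis by (auto simp: frac_PV_eq_def)
qed

context arctan_mixture
begin

definition Lu :: "real \<Rightarrow> real \<Rightarrow> real" where
  "Lu s x = 2 / pi * ln_frac_const s * mix_Im (2 * s) x"

lemma frac_PV_eq_u:
  assumes s: "0 < s" "s < 1"
  shows "frac_PV_eq s u x (Lu s x)"
proof (rule frac_PV_eqI[OF s(1) continuous_on_u, where B = 1])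
  show "\<bar>u x\<bar> \<le> 1" for x using u_bounds[of x] by (simp add: abs_le_iff)
  define d where "d j h = frac_kernel s h * arctan_diff2 (l j) x h" for j h
  \<comment> \<open>A majorant of all \<open>d j\<close> that does not depend on \<open>j\<close>;
    with summable weights it justifies integrating the series term by term.\<close>
  define b where "b h = frac_kernel s h * (if h \<le> 1 then 2 * h\<^sup>2 else 2 * pi)" for h
  have d_int: "integrable lborel (d j)" for j
    unfolding d_def[abs_def] by (rule integral_arctan_diff2(1)[OF s l_pos])
  have d_val: "(\<integral>h. d j h \<partial>lborel) = ln_frac_const s * cpow_Im (2 * s) (l j) x" for j
    unfolding d_def integral_arctan_diff2(2)[OF s l_pos] by (simp add: cpow_Im_def)
  have "integrable lborel (\<lambda>h. frac_kernel s h *\<^sub>R (if h \<le> 1 then 2 * h\<^sup>2 else 2 * pi))"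
  proof (rule integrable_frac_kernel_bound[OF s])
    fix h :: real assume "1 < h"
    then have "2 * pi * 1 \<le> 2 * pi * h powr s"
      using s by (intro mult_left_mono ge_one_powr_ge_zero) auto
    then show "norm (if h \<le> 1 then 2 * h\<^sup>2 else 2 * pi) \<le> 2 * pi * h powr s"
      using \<open>1 < h\<close> by simp
  next
    show "norm (if h \<le> 1 then 2 * h\<^sup>2 else 2 * pi) \<le> 2 * h\<^sup>2" if "h \<le> 1" for h :: real
      using that by simp
  qed simp
  then have b_int: "integrable lborel b" by (simp add: b_def[abs_def])
  have d_le: "\<bar>d j h\<bar> \<le> b h" for j h
    using abs_arctan_diff2_le[OF l_ge_1[of j], of x h]
    by (auto simp: d_def b_def abs_mult frac_kernel_nonneg intro!: mult_left_mono)
  have sum_d: "summable (\<lambda>j. \<integral>h. norm (w j * d j h) \<partial>lborel)"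
  proof (rule summable_comparison_test')
    show "summable (\<lambda>j. w j * (\<integral>h. b h \<partial>lborel))" by (intro summable_mult2 w_summable)
    fix j
    have "(\<integral>h. \<bar>d j h\<bar> \<partial>lborel) \<le> (\<integral>h. b h \<partial>lborel)"
      using d_int b_int d_le by (intro integral_mono) auto
    then show "norm (\<integral>h. norm (w j * d j h) \<partial>lborel) \<le> w j * (\<integral>h. b h \<partial>lborel)"
      using w_nonneg[of j] by (simp add: abs_mult mult_left_mono)
  qed
  have sum_h: "summable (\<lambda>j. norm (w j * d j h))" for h
  proof (rule summable_comparison_test')
    show "summable (\<lambda>j. w j * b h)" by (intro summable_mult2 w_summable)
    show "norm (norm (w j * d j h)) \<le> w j * b h" for j
      using d_le[of j h] w_nonneg[of j] by (simp add: abs_mult mult_left_mono)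
  qed
  have wd_int: "integrable lborel (\<lambda>h. w j * d j h)" for j using d_int by simp
  have diff2: "frac_kernel s h * (u (x + h) + u (x - h) - 2 * u x) = 2 / pi * (\<Sum>j. w j * d j h)" for h
  proof -
    have "(\<lambda>j. w j * arctan ((x + h) / l j) + w j * arctan ((x - h) / l j) - 2 * (w j * arctan (x / l j))) sums
        ((\<Sum>j. w j * arctan ((x + h) / l j)) + (\<Sum>j. w j * arctan ((x - h) / l j))
          - 2 * (\<Sum>j. w j * arctan (x / l j)))"
      by (intro sums_diff sums_add sums_mult summable_sums u_summable)
    from sums_unique[OF this]
    have "(\<Sum>j. w j * arctan ((x + h) / l j)) + (\<Sum>j. w j * arctan ((x - h) / l j))
        - 2 * (\<Sum>j. w j * arctan (x / l j))
        = (\<Sum>j. w j * arctan ((x + h) / l j) + w j * arctan ((x - h) / l j) - 2 * (w j * arctan (x / l j)))"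
      by simp
    also have "\<dots> = (\<Sum>j. w j * arctan_diff2 (l j) x h)"
      by (simp add: arctan_diff2_def algebra_simps)
    finally have eq: "(\<Sum>j. w j * arctan ((x + h) / l j)) + (\<Sum>j. w j * arctan ((x - h) / l j))
        - 2 * (\<Sum>j. w j * arctan (x / l j)) = (\<Sum>j. w j * arctan_diff2 (l j) x h)" .
    have "c * a + c * b - 2 * (c * d) = c * (a + b - 2 * d)" for a b c d :: real
      by (simp add: algebra_simps)
    then have "u (x + h) + u (x - h) - 2 * u x = 2 / pi * (\<Sum>j. w j * arctan_diff2 (l j) x h)"
      unfolding u_def eq[symmetric] .
    also have "frac_kernel s h * \<dots> = 2 / pi * (frac_kernel s h * (\<Sum>j. w j * arctan_diff2 (l j) x h))"
      by simp
    also have "frac_kernel s h * (\<Sum>j. w j * arctan_diff2 (l j) x h) = (\<Sum>j. w j * d j h)"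
      unfolding d_def mult.left_commute[of "w _"]
      by (rule suminf_mult[symmetric], rule weighted_summable, rule abs_arctan_diff2_le(2)[OF l_ge_1])
    finally show ?thesis .
  qed
  note sw = AE_I2[of lborel, OF sum_h]
  show "integrable lborel (\<lambda>h. frac_kernel s h * (u (x + h) + u (x - h) - 2 * u x))"
    unfolding diff2 using integrable_suminf[OF wd_int sw sum_d] by simp
  have "(\<integral>h. frac_kernel s h * (u (x + h) + u (x - h) - 2 * u x) \<partial>lborel)
      = 2 / pi * (\<integral>h. (\<Sum>j. w j * d j h) \<partial>lborel)"
    unfolding diff2 by simp
  also have "(\<integral>h. (\<Sum>j. w j * d j h) \<partial>lborel) = (\<Sum>j. \<integral>h. w j * d j h \<partial>lborel)"
    by (rule integral_suminf[OF wd_int sw sum_d])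
  also have "\<dots> = (\<Sum>j. ln_frac_const s * (w j * cpow_Im (2 * s) (l j) x))"
    by (simp add: d_val mult.left_commute)
  also have "\<dots> = ln_frac_const s * mix_Im (2 * s) x"
    unfolding mix_Im_def using s by (intro suminf_mult mix_summable) auto
  finally show "(\<integral>h. frac_kernel s h * (u (x + h) + u (x - h) - 2 * u x) \<partial>lborel) = Lu s x"
    by (simp add: Lu_def)
qed

lemma in_X_u: "in_X u"
  unfolding in_X_def set_integrable_def
  by (intro conjI allI impI borel_integrable_compact continuous_on_u u_tendsto_1 u_tendsto_m1)

end

section \<open>Recovering the potential\<close>

lemma ex_antiderivative:
  fixes f :: "real \<Rightarrow> real"
  assumes "continuous_on UNIV f"
  obtains F where "F c = 0" "\<And>x. (F has_real_derivative f x) (at x)"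
proof -
  have "isCont f x" for x using assms by (simp add: continuous_on_eq_continuous_at)
  then obtain F where F: "(F has_vector_derivative f x) (at x)" for x
    using einterval_antiderivative[of "-\<infinity>" "\<infinity>" f] by auto
  show ?thesis
  proof (rule that[of "\<lambda>x. F x - F c"])
    show "((\<lambda>x. F x - F c) has_real_derivative f x) (at x)" for x
      using F[of x] by (auto intro!: derivative_eq_intros simp: has_real_derivative_iff_has_vector_derivative)
  qed simp
qed

text \<open>The potential is built from its second derivative \<open>g' / u'\<close>, transported by \<open>u\<close> to
  \<open>(-1, 1)\<close> and extended by zero; the bound on \<open>R'\<close> makes this extension Lipschitz.\<close>

lemma ex_potential:
  fixes u v g g' R' :: "real \<Rightarrow> real"
  defines "R \<equiv> \<lambda>x. g' x / v x"
  assumes du: "\<And>x. (u has_real_derivative v x) (at x)" and v_pos: "\<And>x. v x > 0"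
    and u_odd: "\<And>x. u (-x) = - u x" and u_lim: "(u \<longlongrightarrow> 1) at_top" and u_less: "\<And>x. u x < 1"
    and dg: "\<And>x. (g has_real_derivative g' x) (at x)" and g_odd: "\<And>x. g (-x) = - g x"
    and g_lim: "(g \<longlongrightarrow> 0) at_top" and g_neg: "\<And>x. x > 0 \<Longrightarrow> g x < 0"
    and dR: "\<And>x. (R has_real_derivative R' x) (at x)" and R'_le: "\<And>x. \<bar>R' x\<bar> \<le> B * v x"
    and R_even: "\<And>x. R (-x) = R x" and R_lim: "(R \<longlongrightarrow> 0) at_top"
  obtains W \<omega> Z where
    "\<And>t. (W has_real_derivative \<omega> t) (at t)" "\<And>t. (\<omega> has_real_derivative Z t) (at t)"
    "\<And>s t. \<bar>Z s - Z t\<bar> \<le> B * \<bar>s - t\<bar>" "\<And>t. Z (-t) = Z t"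
    "\<And>x. Z (u x) = R x" "\<And>x. \<omega> (u x) = g x" "\<omega> 1 = 0" "\<omega> (-1) = 0"
    "W 1 = 0" "W (-1) = 0" "\<And>t. 0 \<le> W t" "\<And>t. -1 < t \<Longrightarrow> t < 1 \<Longrightarrow> 0 < W t"
proof -
  have mono: "u x < u y" if "x < y" for x y
    using that du v_pos by (intro DERIV_pos_imp_increasing[of x y u]) auto
  have inj: "inj u" by (rule injI) (metis mono linorder_neqE_linordered_idom less_irrefl)
  have u0: "u 0 = 0" using u_odd[of 0] by simp
  have u_gr: "-1 < u x" for x using u_less[of "-x"] u_odd[of x] by simp
  have u_cont: "continuous_on A u" for A
    using du by (intro continuous_at_imp_continuous_on ballI) (rule DERIV_isCont)
  have minus_bot: "LIM x at_bot. - x :> (at_top :: real filter)"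
    by (rule filterlim_uminus_at_top_at_bot)
  have u_lim': "(u \<longlongrightarrow> -1) at_bot"
    using tendsto_minus[OF filterlim_compose[OF u_lim minus_bot]] by (simp add: u_odd)
  have g_lim': "(g \<longlongrightarrow> 0) at_bot"
    using tendsto_minus[OF filterlim_compose[OF g_lim minus_bot]] by (simp add: g_odd)
  have surj: "\<exists>x. u x = t" if "-1 < t" "t < 1" for t
  proof -
    obtain a where a: "t < u a"
      using eventually_happens[OF order_tendstoD(1)[OF u_lim \<open>t < 1\<close>]] by auto
    obtain b where b: "u b < t"
      using eventually_happens[OF order_tendstoD(2)[OF u_lim' \<open>-1 < t\<close>]] by auto
    have "b \<le> a" using a b mono[of a b] by linarith
    then show ?thesis using IVT'[of u b t a] a b u_cont by auto
  qed
  have surj': "\<exists>x. u x = t" if "\<bar>t\<bar> < 1" for t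
    using that surj[of t] by (simp add: abs_less_iff)
  define Z where "Z t = (if \<bar>t\<bar> < 1 then R (inv u t) else 0)" for t
  have Zu: "Z (u x) = R x" for x
    using u_less[of x] u_gr[of x] by (simp add: Z_def inv_f_f[OF inj] abs_less_iff)
  have Z_even: "Z (-t) = Z t" for t
  proof (cases "\<bar>t\<bar> < 1")
    case True
    then obtain x where "u x = t" using surj'[of t] by blast
    then show ?thesis using Zu[of x] Zu[of "-x"] by (simp add: u_odd R_even)
  qed (simp add: Z_def)
  \<comment> \<open>Both \<open>B * u - R\<close> and \<open>B * u + R\<close> are nondecreasing
    because \<open>B * v\<close> dominates the derivative of \<open>R\<close>. This says that
    \<open>R\<close> is Lipschitz as a function of the value of \<open>u\<close>.\<close>
  have lip_less: "\<bar>R x - R y\<bar> \<le> B * \<bar>u x - u y\<bar>" if "x < y" for x y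
  proof -
    have "B * u x - R x \<le> B * u y - R y"
    proof (rule DERIV_nonneg_imp_nondecreasing[where f = "\<lambda>x. B * u x - R x"])
      fix t
      have "((\<lambda>x. B * u x - R x) has_real_derivative B * v t - R' t) (at t)"
        by (auto intro!: derivative_eq_intros du dR)
      then show "\<exists>d. ((\<lambda>x. B * u x - R x) has_real_derivative d) (at t) \<and> 0 \<le> d"
        using R'_le[of t] by (intro exI conjI) auto
    qed (use that in simp)
    moreover have "B * u x + R x \<le> B * u y + R y"
    proof (rule DERIV_nonneg_imp_nondecreasing[where f = "\<lambda>x. B * u x + R x"])
      fix t
      have "((\<lambda>x. B * u x + R x) has_real_derivative B * v t + R' t) (at t)"
        by (auto intro!: derivative_eq_intros du dR)
      then show "\<exists>d. ((\<lambda>x. B * u x + R x) has_real_derivative d) (at t) \<and> 0 \<le> d"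
        using R'_le[of t] by (intro exI conjI) auto
    qed (use that in simp)
    moreover have "\<bar>u x - u y\<bar> = u y - u x" using mono[OF that] by simp
    ultimately show ?thesis by (simp add: abs_le_iff right_diff_distrib)
  qed
  have lip_R: "\<bar>R x - R y\<bar> \<le> B * \<bar>u x - u y\<bar>" for x y
    using lip_less[of x y] lip_less[of y x] by (cases x y rule: linorder_cases) (auto simp: abs_minus_commute)
  \<comment> \<open>Let \<open>y\<close> tend to infinity in \<open>lip_R\<close>. This linear decay
    towards the endpoint is what glues \<open>Z\<close> to its extension by zero with the same
    constant \<open>B\<close>.\<close>
  have R_le: "\<bar>R x\<bar> \<le> B * (1 - u x)" for x
  proof (rule tendsto_le)
    show "((\<lambda>y. \<bar>R x - R y\<bar>) \<longlongrightarrow> \<bar>R x\<bar>) at_top"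
      using tendsto_rabs[OF tendsto_diff[OF tendsto_const R_lim]] by simp
    show "((\<lambda>y. B * \<bar>u x - u y\<bar>) \<longlongrightarrow> B * (1 - u x)) at_top"
      using tendsto_mult_left[OF tendsto_rabs[OF tendsto_diff[OF tendsto_const u_lim]], of B "u x"] u_less[of x]
      by simp
  qed (auto simp: lip_R)
  have B: "B \<ge> 0"
    using order_trans[OF abs_ge_zero R'_le[of 0]] v_pos[of 0] by (simp add: zero_le_mult_iff)
  have Z_le: "\<bar>Z t\<bar> \<le> B * (1 - \<bar>t\<bar>)" if "\<bar>t\<bar> < 1" for t
  proof -
    obtain x where x: "u x = t" using surj'[of t] \<open>\<bar>t\<bar> < 1\<close> by blast
    have "\<bar>Z t\<bar> \<le> B * (1 - t)" "\<bar>Z t\<bar> \<le> B * (1 - (- t))"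
      using R_le[of x] R_le[of "-x"] Zu[of x] x by (simp_all add: u_odd R_even)
    then show ?thesis by (cases "t \<ge> 0") auto
  qed
  have Z_lip_out: "\<bar>Z a\<bar> \<le> B * \<bar>a - b\<bar>" if "\<bar>a\<bar> < 1" "\<not> \<bar>b\<bar> < 1" for a b
  proof -
    have "\<bar>Z a\<bar> \<le> B * (1 - \<bar>a\<bar>)" by (rule Z_le) fact
    also have "\<dots> \<le> B * \<bar>a - b\<bar>" using B that by (intro mult_left_mono) auto
    finally show ?thesis .
  qed
  have Z_lip: "\<bar>Z a - Z b\<bar> \<le> B * \<bar>a - b\<bar>" for a b
  proof -
    have z: "Z t = 0" if "\<not> \<bar>t\<bar> < 1" for t using that by (simp add: Z_def)
    consider "\<bar>a\<bar> < 1" "\<bar>b\<bar> < 1" | "\<bar>a\<bar> < 1" "\<not> \<bar>b\<bar> < 1" | "\<not> \<bar>a\<bar> < 1" "\<bar>b\<bar> < 1" | "\<not> \<bar>a\<bar> < 1" "\<not> \<bar>b\<bar> < 1"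
      by blast
    then show ?thesis
    proof cases
      case 1
      then obtain x y where "u x = a" "u y = b" using surj'[of a] surj'[of b] by blast
      then show ?thesis using lip_R[of x y] Zu[of x] Zu[of y] by simp
    next
      case 2
      then show ?thesis using Z_lip_out[of a b] z[of b] by simp
    next
      case 3
      then show ?thesis using Z_lip_out[of b a] z[of a] by (simp add: abs_minus_commute)
    next
      case 4
      then show ?thesis using z[of a] z[of b] B by simp
    qed
  qed
  have Z_cont: "continuous_on UNIV Z"
    using Z_lip B by (intro lipschitz_on_continuous_on[of B] lipschitz_onI) (auto simp: dist_real_def)
  obtain \<omega> where \<omega>m1: "\<omega> (-1) = 0" and d\<omega>: "\<And>t. (\<omega> has_real_derivative Z t) (at t)"
    using ex_antiderivative[OF Z_cont] by blast
  have \<omega>_cont: "isCont \<omega> t" for t using d\<omega> by (rule DERIV_isCont)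
  \<comment> \<open>By the chain rule \<open>\<omega> (u x)\<close> has derivative
    \<open>Z (u x) * v x = g' x\<close>, so it differs from \<open>g\<close> by a constant; the
    normalisation at -1 and the limits at minus infinity make it 0. The zero of
    \<open>\<omega>\<close> at 1 is no second normalisation: it comes from \<open>g\<close>
    vanishing at plus infinity.\<close>
  have d0: "\<forall>x. ((\<lambda>x. \<omega> (u x) - g x) has_real_derivative 0) (at x)"
  proof
    fix x
    have "((\<lambda>x. \<omega> (u x) - g x) has_real_derivative Z (u x) * v x - g' x) (at x)"
      by (intro DERIV_diff dg DERIV_chain2[OF d\<omega> du])
    moreover have "Z (u x) * v x - g' x = 0" using v_pos[of x] by (simp add: Zu R_def)
    ultimately show "((\<lambda>x. \<omega> (u x) - g x) has_real_derivative 0) (at x)" by simp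
  qed
  have const: "\<omega> (u x) - g x = \<omega> (u y) - g y" for x y
    by (rule DERIV_isconst_all[OF d0])
  obtain c where c: "\<And>x. \<omega> (u x) - g x = c" using const by blast
  have "((\<lambda>x. \<omega> (u x) - g x) \<longlongrightarrow> \<omega> (-1) - 0) at_bot"
    by (intro tendsto_diff g_lim' isCont_tendsto_compose[OF \<omega>_cont u_lim'])
  from this[unfolded c \<omega>m1] have "((\<lambda>x::real. c) \<longlongrightarrow> 0) at_bot" by simp
  then have "c = 0" by (simp add: tendsto_const_iff)
  then have \<omega>u: "\<omega> (u x) = g x" for x using c[of x] by simp
  have "((\<lambda>x. \<omega> (u x)) \<longlongrightarrow> \<omega> 1) at_top"
    by (rule isCont_tendsto_compose[OF \<omega>_cont u_lim])
  then have \<omega>1: "\<omega> 1 = 0"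
    unfolding \<omega>u using g_lim tendsto_unique[of at_top] by (metis trivial_limit_at_top_linorder)
  have \<omega>_out: "\<omega> t = 0" if "\<bar>t\<bar> \<ge> 1" for t
  proof (cases "t \<ge> 1")
    case True
    have "\<exists>c. \<forall>x\<in>{1..}. \<omega> x = c"
    proof (rule has_field_derivative_zero_constant)
      show "(\<omega> has_real_derivative 0) (at x within {1..})" if "x \<in> {1..}" for x
        using d\<omega>[of x] that by (auto simp: Z_def intro: has_field_derivative_at_within)
    qed simp
    then show ?thesis using \<omega>1 True by (metis atLeast_iff order_refl)
  next
    case False
    have "\<exists>c. \<forall>x\<in>{..-1}. \<omega> x = c"
    proof (rule has_field_derivative_zero_constant)
      show "(\<omega> has_real_derivative 0) (at x within {..-1})" if "x \<in> {..-1}" for x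
        using d\<omega>[of x] that by (auto simp: Z_def intro: has_field_derivative_at_within)
    qed simp
    moreover have "t \<le> -1" using False that by linarith
    ultimately show ?thesis using \<omega>m1 by (metis atMost_iff order_refl)
  qed
  have \<omega>_odd: "\<omega> (-t) = - \<omega> t" for t
  proof (cases "\<bar>t\<bar> < 1")
    case True
    then obtain x where "u x = t" using surj'[of t] by blast
    then show ?thesis using \<omega>u[of x] \<omega>u[of "-x"] by (simp add: u_odd g_odd)
  qed (simp add: \<omega>_out)
  have "continuous_on UNIV \<omega>" using \<omega>_cont by (simp add: continuous_on_eq_continuous_at)
  then obtain W where Wm1: "W (-1) = 0" and dW: "\<And>t. (W has_real_derivative \<omega> t) (at t)"
    using ex_antiderivative by blast
  have d1: "\<forall>t. ((\<lambda>t. W t - W (-t)) has_real_derivative 0) (at t)"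
  proof
    fix t
    have "((\<lambda>t. W t - W (-t)) has_real_derivative \<omega> t - \<omega> (-t) * (-1)) (at t)"
      by (intro DERIV_diff dW DERIV_chain2[OF dW]) (auto intro!: derivative_eq_intros)
    then show "((\<lambda>t. W t - W (-t)) has_real_derivative 0) (at t)" by (simp add: \<omega>_odd)
  qed
  have "W t - W (-t) = W 0 - W (-0)" for t by (rule DERIV_isconst_all[OF d1])
  then have W_even: "W (-t) = W t" for t by simp
  \<comment> \<open>Start from the zero at -1: on (-1, 0) the derivative of \<open>W\<close> is a
    value of \<open>g\<close> at a negative point, hence positive by oddness. Evenness of
    \<open>W\<close> then covers the other half.\<close>
  have W_pos': "W t > 0" if "-1 < t" "t \<le> 0" for t
  proof -
    have "W (-1) < W t"
    proof (rule DERIV_pos_imp_increasing_open[OF that(1)])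
      fix r assume r: "-1 < r" "r < t"
      have "r < 1" using r that by linarith
      then obtain x where x: "u x = r" using surj[of r] r by blast
      have "x < 0" using mono[of 0 x] u0 x r that by (cases x "0::real" rule: linorder_cases) auto
      then have "\<omega> r > 0" using \<omega>u[of x] x g_neg[of "-x"] g_odd[of x] by simp
      then show "\<exists>d. (W has_real_derivative d) (at r) \<and> d > 0" using dW by blast
    next
      show "continuous_on {-1..t} W"
        using dW by (intro continuous_at_imp_continuous_on ballI) (rule DERIV_isCont)
    qed
    then show ?thesis using Wm1 by simp
  qed
  have W_pos: "W t > 0" if "-1 < t" "t < 1" for t
    using W_pos'[of t] W_pos'[of "-t"] W_even[of t] that by (cases "t \<le> 0") auto
  have W_out': "W t = 0" if "t \<le> -1" for t
  proof -
    have "\<exists>c. \<forall>x\<in>{..-1}. W x = c"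
    proof (rule has_field_derivative_zero_constant)
      show "(W has_real_derivative 0) (at x within {..-1})" if "x \<in> {..-1}" for x
        using dW[of x] that \<omega>_out[of x] by (auto intro: has_field_derivative_at_within)
    qed simp
    then show ?thesis using Wm1 that by (metis atMost_iff order_refl)
  qed
  have W_nonneg: "0 \<le> W t" for t
  proof -
    consider "t \<le> -1" | "- t \<le> -1" | "-1 < t" "t < 1" by linarith
    then show ?thesis using W_pos[of t] W_out'[of t] W_out'[of "-t"] W_even[of t] by cases auto
  qed
  show ?thesis
    by (rule that[OF dW d\<omega> Z_lip Z_even Zu \<omega>u \<omega>1 \<omega>m1 _ Wm1 W_nonneg W_pos])
      (use W_even[of 1] Wm1 in simp_all)
qed

section \<open>Geometric scales\<close>

locale frac_order =
  fixes s :: real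
  assumes s_pos: "0 < s" and s_less: "s < 1"
begin

text \<open>Chosen so that \<open>N powr (s / 2) = 20\<close>. The scales have ratio
  \<open>N\<^sup>2\<close>, hence \<open>lam j powr (s / 2) = 400 ^ j\<close>, and 399 / 400
  normalises the geometric weights. Half a period, from \<open>lam k\<close> to
  \<open>N * lam k\<close>, thus changes the comparison power by the factor 20, enough for a visible
  oscillation.\<close>

definition N :: real where "N = 20 powr (2 / s)"

definition wt :: "nat \<Rightarrow> real" where "wt j = 399 / 400 * (1 / 400) ^ j"

definition lam :: "nat \<Rightarrow> real" where "lam j = (N\<^sup>2) ^ j"

lemma N_ge: "N \<ge> 400"
proof -
  have "(20::real) powr 2 \<le> 20 powr (2 / s)"
    using s_pos s_less by (intro powr_mono) (auto simp: field_simps)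
  then show ?thesis by (simp add: N_def)
qed

lemma N2_ge: "N\<^sup>2 \<ge> 800"
  using N_ge mult_mono[of 400 N 400 N] by (simp add: power2_eq_square)

lemma lam_ge_1: "lam j \<ge> 1"
  unfolding lam_def by (rule one_le_power) (use N2_ge in linarith)

lemma wt_sums: "wt sums 1"
proof -
  have "(\<lambda>j. (399 / 400) * (1 / 400) ^ j) sums ((399 / 400) * (1 / (1 - 1 / 400)) :: real)"
    by (intro sums_mult geometric_sums) simp
  then show ?thesis by (simp add: wt_def[abs_def])
qed

sublocale arctan_mixture wt lam
proof unfold_locales
  show "0 < wt j" for j by (simp add: wt_def)
qed (rule wt_sums lam_ge_1)+

lemma N_powr: "N powr (s / 2) = 20"
  using s_pos by (simp add: N_def powr_powr)

lemma lam_powr: "lam j powr (s / 2) = 400 ^ j"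
proof -
  have N: "N > 0" using N_ge by simp
  have "lam j = N powr (real (2 * j))"
    using powr_realpow[OF N, of "2 * j"] by (simp only: lam_def power_mult)
  then have "lam j powr (s / 2) = (N powr (s / 2)) powr real (2 * j)"
    by (simp add: powr_powr mult.commute)
  also have "\<dots> = 20 ^ (2 * j)" unfolding N_powr by (subst powr_realpow) auto
  finally show ?thesis by (simp add: power_mult)
qed

lemma lam_powr_minus: "lam j powr (- (s / 2)) = (1 / 400) ^ j"
  by (simp add: powr_minus lam_powr power_one_over inverse_eq_divide)

lemma lam_Suc: "lam (Suc j) = N\<^sup>2 * lam j" by (simp add: lam_def)

lemma wt_tail: "(\<Sum>i. wt (i + n)) = (1 / 400) ^ n"
proof -
  have "(\<lambda>i. (1 / 400) ^ n * wt i) sums ((1 / 400) ^ n * 1)" by (intro sums_mult wt_sums)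
  then have "(\<lambda>i. wt (i + n)) sums ((1 / 400) ^ n)" by (simp add: wt_def power_add mult_ac)
  then show ?thesis by (rule sums_unique[symmetric])
qed

text \<open>Consecutive terms grow by the factor \<open>N\<^sup>2 / 400\<close>, which is at least
  2, so the sum is controlled by its last term.\<close>

lemma wt_lam_sum: "(\<Sum>i<Suc j. wt i * lam i) \<le> 2 * (lam j * (1 / 400) ^ j)"
proof (induction j)
  case 0
  then show ?case by (simp add: wt_def lam_def)
next
  case (Suc j)
  have pos: "lam j * (1 / 400) ^ j > 0" using l_pos[of j] by simp
  have step: "lam (Suc j) * (1 / 400) ^ Suc j = (N\<^sup>2 / 400) * (lam j * (1 / 400) ^ j)"
    by (simp add: lam_Suc)
  have "2 * (lam j * (1 / 400) ^ j) \<le> lam (Suc j) * (1 / 400) ^ Suc j"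
    unfolding step using N2_ge pos by (intro mult_right_mono) auto
  moreover have "wt (Suc j) * lam (Suc j) \<le> lam (Suc j) * (1 / 400) ^ Suc j"
    using l_pos[of "Suc j"] by (simp add: wt_def)
  moreover have "(\<Sum>i<Suc (Suc j). wt i * lam i) = (\<Sum>i<Suc j. wt i * lam i) + wt (Suc j) * lam (Suc j)"
    by (rule sum.lessThan_Suc)
  ultimately show ?case using Suc.IH by linarith
qed

lemma one_minus_u_bound:
  assumes "x > 0"
  shows "1 - u x \<le> (1 / 400) ^ Suc j + 2 * (lam j * (1 / 400) ^ j) / x"
proof -
  have "1 - u x \<le> (1 / 400) ^ Suc j + (\<Sum>i<Suc j. wt i * lam i) / x"
    using one_minus_u_le[OF assms, of "Suc j"] by (simp only: wt_tail)
  also have "\<dots> \<le> (1 / 400) ^ Suc j + 2 * (lam j * (1 / 400) ^ j) / x"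
    using wt_lam_sum[of j] assms by (intro add_left_mono divide_right_mono) auto
  finally show ?thesis .
qed

lemma ex_scale:
  assumes "x \<ge> 1"
  obtains j where "lam j \<le> x" "x < lam (Suc j)"
proof -
  obtain n where n: "x < (N\<^sup>2) ^ n" using real_arch_pow[of "N\<^sup>2" x] N2_ge by auto
  define m where "m = (LEAST n. x < lam n)"
  have m: "x < lam m" unfolding m_def by (rule LeastI[of "\<lambda>n. x < lam n" n]) (simp add: lam_def n)
  have "m \<noteq> 0" using m assms by (auto simp: lam_def intro: gr0I)
  then obtain j where j: "m = Suc j" using not0_implies_Suc by blast
  have "\<not> x < lam j" using not_less_Least[of j "\<lambda>n. x < lam n"] j unfolding m_def by simp
  with m j show ?thesis by (intro that[of j]) auto
qed

text \<open>Choose \<open>j\<close> with \<open>lam j <= x < lam (Suc j)\<close>. The later weights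
  sum to \<open>lam (Suc j) powr (- (s / 2))\<close>, costing 1; the earlier scales give
  \<open>2 * lam j powr (1 - s / 2) / x\<close>, costing 2.\<close>

lemma one_minus_u_upper:
  assumes x: "x \<ge> 1"
  shows "1 - u x \<le> 3 * x powr (- (s / 2))"
proof -
  obtain j where j: "lam j \<le> x" "x < lam (Suc j)" using ex_scale[OF x] .
  have "(1 / 400) ^ Suc j = lam (Suc j) powr (- (s / 2))" by (simp only: lam_powr_minus)
  also have "\<dots> \<le> x powr (- (s / 2))"
    using x j s_pos by (intro powr_mono2') auto
  finally have 1: "(1 / 400) ^ Suc j \<le> x powr (- (s / 2))" .
  have "lam j * (1 / 400) ^ j = lam j powr 1 * lam j powr (- (s / 2))"
    using l_pos[of j] by (simp add: lam_powr_minus)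
  also have "\<dots> = lam j powr (1 - s / 2)" by (simp add: powr_add[symmetric] del: powr_one powr_one')
  also have "\<dots> \<le> x powr (1 - s / 2)"
    using j s_less l_pos[of j] by (intro powr_mono2) auto
  also have "\<dots> = x * x powr (- (s / 2))"
    using x by (subst powr_mult_base) auto
  finally have "2 * (lam j * (1 / 400) ^ j) / x \<le> 2 * x powr (- (s / 2))"
    using x by (simp add: divide_le_eq mult_ac)
  with one_minus_u_bound[of x j] 1 x show ?thesis by linarith
qed

section \<open>Power bounds for the slope and the higher derivatives\<close>

definition v :: "real \<Rightarrow> real" where "v x = 2 / pi * mix_Re 1 x"

lemma DERIV_u_v: "(u has_real_derivative v x) (at x)"
  unfolding v_def by (rule DERIV_u)

lemma v_pos: "v x > 0" using mix_Re_1_pos[of x] by (simp add: v_def)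

lemma v_ge: "2 / pi * (wt j * (lam j / ((lam j)\<^sup>2 + x\<^sup>2))) \<le> v x"
  unfolding v_def using mix_Re_1_ge[of j x] by (intro mult_left_mono) auto

lemma v_even: "v (-x) = v x" by (simp add: v_def mix_parity)

lemma x_v_le: "x > 0 \<Longrightarrow> x * v x \<le> 1 - u x"
  unfolding v_def by (rule x_deriv_u_le)

text \<open>Replaces the modulus of \<open>x\<close> so that the power bounds hold on the whole
  line; being at least 1, it always lies between two consecutive scales.\<close>

definition rho :: "real \<Rightarrow> real" where "rho x = sqrt (1 + x\<^sup>2)"

lemma rho_ge_1: "rho x \<ge> 1" by (simp add: rho_def)

definition vc :: real where "vc = 399 / (400 * pi * N\<^sup>2)"

lemma vc_pos: "vc > 0" using N_ge by (simp add: vc_def)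

text \<open>One term suffices: for \<open>lam j <= rho x < N\<^sup>2 * lam j\<close> the weight is
  at least 399 / 400 times \<open>rho x powr (- (s / 2))\<close>, the numerator at least
  \<open>rho x / N\<^sup>2\<close> and the denominator at most \<open>2 * (rho x)\<^sup>2\<close>.
  With the factor \<open>2 / pi\<close> this gives exactly \<open>vc\<close>.\<close>

lemma v_lower: "vc * rho x powr (- (1 + s / 2)) \<le> v x"
proof -
  obtain j where j: "lam j \<le> rho x" "rho x < lam (Suc j)" using ex_scale[OF rho_ge_1] .
  have r: "rho x > 0" using rho_ge_1[of x] by linarith
  have r2: "(rho x)\<^sup>2 = 1 + x\<^sup>2" by (simp add: rho_def)
  have N: "N\<^sup>2 > 0" using N2_ge by linarith
  have "rho x powr (- (s / 2)) \<le> lam j powr (- (s / 2))"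
    using j s_pos l_pos[of j] by (intro powr_mono2') auto
  then have w: "399 / 400 * rho x powr (- (s / 2)) \<le> wt j"
    by (simp add: wt_def lam_powr_minus)
  have l: "rho x / N\<^sup>2 \<le> lam j" using j N by (simp add: lam_Suc divide_le_eq mult.commute)
  have d: "(lam j)\<^sup>2 + x\<^sup>2 \<le> 2 * (rho x)\<^sup>2"
    using power_mono[OF j(1), of 2] l_pos[of j] r2 by simp
  have d0: "(lam j)\<^sup>2 + x\<^sup>2 > 0" using l_pos[of j] by (simp add: add_pos_nonneg)
  have "rho x powr (- (1 + s / 2)) = rho x powr (- (s / 2) - 1)"
    by (rule arg_cong[of _ _ "\<lambda>y. rho x powr y"]) simp
  also have "\<dots> = rho x powr (- (s / 2)) / rho x" using r by (simp only: powr_diff powr_one)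
  finally have "rho x powr (- (1 + s / 2)) = rho x powr (- (s / 2)) / rho x" .
  then have "vc * rho x powr (- (1 + s / 2))
      = 2 / pi * ((399 / 400 * rho x powr (- (s / 2))) * ((rho x / N\<^sup>2) / (2 * (rho x)\<^sup>2)))"
    using r N by (simp add: vc_def power2_eq_square)
  also have "\<dots> \<le> 2 / pi * (wt j * (lam j / ((lam j)\<^sup>2 + x\<^sup>2)))"
    using w l d d0 r N w_nonneg[of j] l_pos[of j]
    by (intro mult_left_mono mult_mono frac_le) auto
  also have "\<dots> \<le> v x" by (rule v_ge)
  finally show ?thesis .
qed

text \<open>The value that the equation prescribes for W' at the point \<open>u x\<close>.\<close>

definition g :: "real \<Rightarrow> real" where "g = Lu s"

definition kap :: real where "kap = 2 / pi * ln_frac_const s"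

definition g' :: "real \<Rightarrow> real" where "g' x = - (2 * s * kap * mix_Re (2 * s + 1) x)"

definition g'' :: "real \<Rightarrow> real" where "g'' x = - (2 * s * kap * ((2 * s + 1) * mix_Im (2 * s + 2) x))"

definition v' :: "real \<Rightarrow> real" where "v' x = 2 / pi * mix_Im 2 x"

lemma kap_pos: "kap > 0"
  using ln_frac_const_pos[OF s_pos s_less] by (simp add: kap_def)

lemma g_eq: "g x = kap * mix_Im (2 * s) x" by (simp add: g_def Lu_def kap_def)

lemma DERIV_g: "(g has_real_derivative g' x) (at x)"
proof -
  have "((\<lambda>x. kap * mix_Im (2 * s) x) has_real_derivative kap * (- (2 * s) * mix_Re (2 * s + 1) x)) (at x)"
    using s_pos by (intro DERIV_cmult DERIV_mix) auto
  then show ?thesis by (simp add: g_eq[abs_def] g'_def mult_ac)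
qed

lemma DERIV_g': "(g' has_real_derivative g'' x) (at x)"
proof -
  have "((\<lambda>x. - (2 * s * kap * mix_Re (2 * s + 1) x)) has_real_derivative
      - (2 * s * kap * ((2 * s + 1) * mix_Im (2 * s + 1 + 1) x))) (at x)"
    using s_pos by (intro DERIV_minus DERIV_cmult DERIV_mix) auto
  then show ?thesis by (simp add: g'_def[abs_def] g''_def add.commute)
qed

lemma DERIV_v: "(v has_real_derivative v' x) (at x)"
proof -
  have "((\<lambda>x. 2 / pi * mix_Re 1 x) has_real_derivative 2 / pi * (1 * mix_Im (1 + 1) x)) (at x)"
    by (intro DERIV_cmult DERIV_mix) auto
  then show ?thesis by (simp add: v_def[abs_def] v'_def)
qed

lemma abs_bounds:
  shows "\<bar>g' x\<bar> \<le> 2 * s * kap * rho x powr (- (2 * s + 1))"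
    and "\<bar>g'' x\<bar> \<le> 2 * s * kap * (2 * s + 1) * rho x powr (- (2 * s + 2))"
    and "\<bar>v' x\<bar> \<le> rho x powr (- 2)"
proof -
  show "\<bar>g' x\<bar> \<le> 2 * s * kap * rho x powr (- (2 * s + 1))"
    using abs_mix_le(1)[of "2 * s + 1" x] s_pos kap_pos unfolding g'_def rho_def
    by (simp only: abs_minus_cancel abs_mult) (auto intro!: mult_left_mono)
  show "\<bar>g'' x\<bar> \<le> 2 * s * kap * (2 * s + 1) * rho x powr (- (2 * s + 2))"
    using abs_mix_le(2)[of "2 * s + 2" x] s_pos kap_pos unfolding g''_def rho_def
    by (simp only: abs_minus_cancel abs_mult) (auto simp: mult.assoc intro!: mult_left_mono)
  have "\<bar>v' x\<bar> = 2 / pi * \<bar>mix_Im 2 x\<bar>" by (simp add: v'_def abs_mult)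
  also have "\<dots> \<le> 1 * rho x powr (- 2)"
    using abs_mix_le(2)[of 2 x] pi_gt3 unfolding rho_def by (intro mult_mono) auto
  finally show "\<bar>v' x\<bar> \<le> rho x powr (- 2)" by simp
qed

text \<open>The derivative of \<open>g' x / v x\<close>, the value that W'' must take at
  \<open>u x\<close>. A bound of \<open>R'\<close> by a multiple of \<open>v\<close> therefore means
  that W'' is Lipschitz in its own variable.\<close>

definition R' :: "real \<Rightarrow> real" where "R' x = (g'' x * v x - g' x * v' x) / (v x * v x)"

lemma DERIV_R: "((\<lambda>x. g' x / v x) has_real_derivative R' x) (at x)"
  unfolding R'_def using v_pos[of x] by (intro DERIV_divide DERIV_g' DERIV_v) auto

text \<open>In powers of \<open>rho\<close>, \<open>g''\<close> over \<open>v\<^sup>2\<close> is of order \<open>- s\<close> and \<open>g' * v'\<close> over \<open>v\<^sup>3\<close> of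
  order \<open>- s / 2\<close>, so both quotients are bounded.\<close>

lemma R'_bound: "\<exists>B. \<forall>x. \<bar>R' x\<bar> \<le> B * v x"
proof -
  define c where "c = vc"
  define A where "A = 2 * s * kap"
  define A2 where "A2 = 2 * s * kap * (2 * s + 1)"
  have c: "c > 0" using vc_pos by (simp add: c_def)
  have A: "A > 0" "A2 > 0" using s_pos kap_pos by (simp_all add: A_def A2_def)
  have "\<bar>R' x\<bar> \<le> (A2 / c\<^sup>2 + A / c ^ 3) * v x" for x
  proof -
    define r where "r = rho x"
    define p where "p = r powr (- (1 + s / 2))"
    have r: "r \<ge> 1" by (simp add: r_def rho_ge_1)
    have p: "p > 0" using r by (simp add: p_def)
    have vp: "c * p \<le> v x" using v_lower[of x] by (simp add: c_def p_def r_def)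
    have le: "r powr (- (2 * s + 2)) \<le> p * p" "r powr (- (2 * s + 1)) * r powr (- 2) \<le> p * p * p"
      unfolding p_def powr_add[symmetric] using r s_pos by (auto intro!: powr_mono)
    have v2: "(c * p) * (c * p) \<le> v x * v x"
      using vp c p v_pos[of x] by (intro mult_mono) auto
    have v3: "(c * p) * (c * p) * (c * p) \<le> v x * v x * v x"
      using vp v2 c p v_pos[of x] by (intro mult_mono) auto
    have "\<bar>g'' x\<bar> \<le> A2 * (p * p)"
      using abs_bounds(2)[of x] mult_left_mono[OF le(1), of A2] A by (simp add: A2_def r_def)
    also have "\<dots> = A2 / c\<^sup>2 * ((c * p) * (c * p))" using c by (simp add: power2_eq_square)
    also have "\<dots> \<le> A2 / c\<^sup>2 * (v x * v x)" using v2 A by (intro mult_left_mono) auto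
    finally have 1: "\<bar>g'' x\<bar> \<le> A2 / c\<^sup>2 * (v x * v x)" .
    have "\<bar>g' x * v' x\<bar> \<le> (A * r powr (- (2 * s + 1))) * r powr (- 2)"
      unfolding abs_mult using abs_bounds(1,3)[of x] A r
      by (intro mult_mono) (auto simp: A_def r_def)
    also have "\<dots> \<le> A * (p * p * p)" using mult_left_mono[OF le(2), of A] A by (simp add: mult.assoc)
    also have "\<dots> = A / c ^ 3 * ((c * p) * (c * p) * (c * p))" using c by (simp add: power3_eq_cube)
    also have "\<dots> \<le> A / c ^ 3 * (v x * v x * v x)" using v3 A c by (intro mult_left_mono) auto
    finally have 2: "\<bar>g' x * v' x\<bar> \<le> A / c ^ 3 * (v x * v x * v x)" .
    have "\<bar>g'' x * v x - g' x * v' x\<bar> \<le> \<bar>g'' x\<bar> * v x + \<bar>g' x * v' x\<bar>"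
      using abs_triangle_ineq4[of "g'' x * v x" "g' x * v' x"] v_pos[of x] by (simp add: abs_mult)
    also have "\<dots> \<le> A2 / c\<^sup>2 * (v x * v x) * v x + A / c ^ 3 * (v x * v x * v x)"
      using 1 2 v_pos[of x] by (intro add_mono mult_right_mono) auto
    also have "\<dots> = ((A2 / c\<^sup>2 + A / c ^ 3) * v x) * (v x * v x)" by (simp add: algebra_simps)
    finally have "\<bar>g'' x * v x - g' x * v' x\<bar> \<le> ((A2 / c\<^sup>2 + A / c ^ 3) * v x) * (v x * v x)" .
    then show ?thesis
      unfolding R'_def using v_pos[of x] by (simp only: abs_divide abs_mult) (simp add: divide_le_eq)
  qed
  then show ?thesis by blast
qed

lemma R_tendsto_0: "((\<lambda>x. g' x / v x) \<longlongrightarrow> 0) at_top"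
proof (rule Lim_null_comparison)
  define c where "c = vc"
  have c: "c > 0" using vc_pos by (simp add: c_def)
  have "norm (g' x / v x) \<le> 2 * s * kap / c * rho x powr (- (3 * s / 2))" for x
  proof -
    have r: "rho x > 0" using rho_ge_1[of x] by linarith
    have "norm (g' x / v x) = \<bar>g' x\<bar> / v x" using v_pos[of x] by (simp add: abs_divide)
    also have "\<dots> \<le> (2 * s * kap * rho x powr (- (2 * s + 1))) / (c * rho x powr (- (1 + s / 2)))"
      using abs_bounds(1)[of x] v_lower[of x] c r by (intro frac_le) (auto simp: c_def)
    also have "\<dots> = 2 * s * kap / c * (rho x powr (- (2 * s + 1)) / rho x powr (- (1 + s / 2)))" by simp
    also have "rho x powr (- (2 * s + 1)) / rho x powr (- (1 + s / 2)) = rho x powr (- (3 * s / 2))"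
      unfolding powr_diff[symmetric] by (rule arg_cong[of _ _ "\<lambda>y. rho x powr y"]) (simp add: field_simps)
    finally show ?thesis .
  qed
  then show "\<forall>\<^sub>F x in at_top. norm (g' x / v x) \<le> 2 * s * kap / c * rho x powr (- (3 * s / 2))"
    by simp
  have "((\<lambda>x. rho x powr (- (3 * s / 2))) \<longlongrightarrow> 0) at_top"
    unfolding rho_def using s_pos by (intro sqrt_powr_tendsto_0) auto
  then show "((\<lambda>x. 2 * s * kap / c * rho x powr (- (3 * s / 2))) \<longlongrightarrow> 0) at_top"
    by (rule tendsto_mult_right_zero)
qed

end

section \<open>Asymptotics and oscillation\<close>

context frac_order
begin

text \<open>The limiting constant \<open>cos (pi * s + pi / 2) = - sin (pi * s)\<close> is negative
  for 0 < s < 1, and the minus sign in \<open>g'\<close> turns it positive. Half of the limit is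
  kept as the constant.\<close>

lemma g'_lower: "\<exists>X c. X \<ge> 1 \<and> c > 0 \<and> (\<forall>x\<ge>X. c * x powr (- (2 * s + 1)) \<le> g' x)"
proof -
  define q where "q = sin (pi * s)"
  have q: "q > 0" unfolding q_def using s_pos s_less by (intro sin_gt_zero) auto
  have "cos ((2 * s + 1) * (pi / 2)) = cos (pi * s + pi / 2)" by (simp add: algebra_simps)
  also have "\<dots> = - q" by (simp add: cos_add q_def)
  finally have "((\<lambda>x. x powr (2 * s + 1) * mix_Re (2 * s + 1) x) \<longlongrightarrow> - q) at_top"
    using mix_Re_limit[of "2 * s + 1"] s_pos by simp
  from order_tendstoD(2)[OF this, of "- q / 2"] q
  have "\<forall>\<^sub>F x in at_top. x powr (2 * s + 1) * mix_Re (2 * s + 1) x < - q / 2" by simp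
  then obtain X where X: "x powr (2 * s + 1) * mix_Re (2 * s + 1) x < - q / 2" if "x \<ge> X" for x
    by (auto simp: eventually_at_top_linorder)
  have A: "2 * s * kap > 0" using s_pos kap_pos by simp
  show ?thesis
  proof (rule exI[of _ "max X 1"], rule exI[of _ "2 * s * kap * (q / 2)"], intro conjI allI impI)
    fix x assume x: "max X 1 \<le> x"
    have "q / 2 * x powr (- (2 * s + 1)) \<le> - (x powr (2 * s + 1) * mix_Re (2 * s + 1) x) * x powr (- (2 * s + 1))"
      using X[of x] x by (intro mult_right_mono) auto
    also have "\<dots> = - mix_Re (2 * s + 1) x * (x powr (2 * s + 1) * x powr (- (2 * s + 1)))" by simp
    also have "x powr (2 * s + 1) * x powr (- (2 * s + 1)) = 1"
      using x by (subst powr_add[symmetric]) simp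
    finally have "2 * s * kap * (q / 2 * x powr (- (2 * s + 1))) \<le> 2 * s * kap * (- mix_Re (2 * s + 1) x)"
      using A by (intro mult_left_mono) auto
    then show "2 * s * kap * (q / 2) * x powr (- (2 * s + 1)) \<le> g' x"
      by (simp add: g'_def mult.assoc)
  qed (use mult_pos_pos[OF A, of "q / 2"] q in simp_all)
qed

text \<open>With \<open>p = x powr (- (s / 2))\<close>, up to constants \<open>g'\<close> is
  \<open>p ^ 4 / x\<close>, the slope is \<open>p / x\<close> and the tail is \<open>p\<close>. The
  quotient is therefore comparable to the cube of the tail: W'' has exponent 3 = 5 - 2.\<close>

lemma potential_growth:
  "\<exists>X c3 c4. X \<ge> 1 \<and> 0 < c3 \<and> 0 < c4 \<and>
    (\<forall>x\<ge>X. c3 * (1 - u x) ^ 3 \<le> g' x / v x \<and> g' x / v x \<le> c4 * (1 - u x) ^ 3)"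
proof -
  obtain X c where X: "X \<ge> 1" and c: "c > 0"
    and g'_ge: "\<And>x. x \<ge> X \<Longrightarrow> c * x powr (- (2 * s + 1)) \<le> g' x"
    using g'_lower by blast
  define A where "A = 2 * s * kap"
  \<comment> \<open>The power of 2 pays for replacing \<open>rho x\<close> by \<open>2 * x\<close>,
    valid for \<open>x >= 1\<close>.\<close>
  define e where "e = vc * 2 powr (- (1 + s / 2))"
  have A: "A > 0" using s_pos kap_pos by (simp add: A_def)
  have e: "e > 0" using vc_pos by (simp add: e_def)
  have "c / 81 * (1 - u x) ^ 3 \<le> g' x / v x \<and> g' x / v x \<le> A / e ^ 4 * (1 - u x) ^ 3" if "x \<ge> X" for x
  proof -
    have x: "x \<ge> 1" "x > 0" using X that by linarith+
    define p where "p = x powr (- (s / 2))"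
    have p: "p > 0" using x by (simp add: p_def)
    have p1: "x powr (- (1 + s / 2)) = p / x"
    proof -
      have "x powr (- (1 + s / 2)) = x powr (- (s / 2) - 1)"
        by (rule arg_cong[of _ _ "\<lambda>y. x powr y"]) simp
      then show ?thesis using x by (simp only: powr_diff powr_one p_def)
    qed
    have p4: "x powr (- (2 * s + 1)) = p ^ 4 / x"
    proof -
      have "x powr (- (2 * s + 1)) = x powr ((- (s / 2)) + (- (s / 2)) + (- (s / 2)) + (- (s / 2)) - 1)"
        by (rule arg_cong[of _ _ "\<lambda>y. x powr y"]) simp
      also have "\<dots> = p * p * p * p / x" using x by (simp only: powr_diff powr_add powr_one p_def)
      finally show ?thesis by (simp add: power4_eq_xxxx)
    qed
    have u3: "1 - u x \<le> 3 * p" using one_minus_u_upper[OF x(1)] by (simp add: p_def)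
    have d0: "0 < 1 - u x" using u_bounds[of x] by simp
    have xv: "x * v x \<le> 1 - u x" using x_v_le[OF x(2)] .
    have v_up: "v x \<le> 3 * p / x" using xv u3 x by (simp add: pos_le_divide_eq mult.commute)
    have "1 + x\<^sup>2 \<le> (2 * x)\<^sup>2"
      using mult_mono[OF x(1) x(1)] x(2) by (simp add: power2_eq_square)
    then have "rho x \<le> 2 * x" unfolding rho_def using x by (intro real_le_lsqrt) auto
    then have "(2 * x) powr (- (1 + s / 2)) \<le> rho x powr (- (1 + s / 2))"
      using rho_ge_1[of x] s_pos by (intro powr_mono2') auto
    from mult_left_mono[OF this, of vc] have "vc * (2 * x) powr (- (1 + s / 2)) \<le> v x"
      using vc_pos v_lower[of x] by linarith
    then have v_lo: "e * p / x \<le> v x"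
      using x by (simp only: e_def powr_mult p1) simp
    \<comment> \<open>The lower bound on the tail is not estimated afresh: it follows from that on
      the slope through \<open>x * v x <= 1 - u x\<close>.\<close>
    have ep: "e * p \<le> 1 - u x"
      using order_trans[OF mult_left_mono[OF v_lo, of x] xv] x by simp
    have lower: "c / 81 * (1 - u x) ^ 3 \<le> g' x / v x"
    proof -
      have "(1 - u x) ^ 3 \<le> (3 * p) ^ 3" using u3 d0 by (intro power_mono) auto
      then have "c / 81 * (1 - u x) ^ 3 \<le> c / 81 * (3 * p) ^ 3" using c by (intro mult_left_mono) auto
      also have "\<dots> = (c * (p ^ 4 / x)) / (3 * p / x)"
        using p x by (simp add: field_simps power3_eq_cube power4_eq_xxxx)
      also have "\<dots> \<le> g' x / v x"
      proof (rule frac_le)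
        show le: "c * (p ^ 4 / x) \<le> g' x" using g'_ge[OF that] unfolding p4 .
        have "0 \<le> c * (p ^ 4 / x)" using c p x by simp
        with le show "0 \<le> g' x" by linarith
      qed (use v_up v_pos[of x] in auto)
      finally show ?thesis .
    qed
    have upper: "g' x / v x \<le> A / e ^ 4 * (1 - u x) ^ 3"
    proof -
      have "g' x \<le> A * rho x powr (- (2 * s + 1))" using abs_bounds(1)[of x] by (simp add: A_def)
      also have "\<dots> \<le> A * x powr (- (2 * s + 1))"
      proof (intro mult_left_mono powr_mono2')
        show "x \<le> rho x" by (simp add: rho_def real_le_rsqrt)
      qed (use A x s_pos in auto)
      finally have "g' x \<le> A * (p ^ 4 / x)" unfolding p4 .
      then have "g' x / v x \<le> (A * (p ^ 4 / x)) / (e * p / x)"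
        using v_lo e p x A by (intro frac_le) auto
      also have "\<dots> = A / e ^ 4 * (e * p) ^ 3"
        using p x e by (simp add: field_simps power3_eq_cube power4_eq_xxxx)
      also have "\<dots> \<le> A / e ^ 4 * (1 - u x) ^ 3"
        using ep e p A by (intro mult_left_mono power_mono) auto
      finally show ?thesis .
    qed
    show ?thesis using lower upper by blast
  qed
  moreover have "0 < c / 81" "0 < A / e ^ 4" using c A e by auto
  ultimately show ?thesis using X by (rule_tac x = X in exI, rule_tac x = "c / 81" in exI, rule_tac x = "A / e ^ 4" in exI) auto
qed

text \<open>The rescaled tail is about \<open>1 / 2\<close> at \<open>lam k\<close> and small at the geometric mean of
  \<open>lam k\<close> and \<open>lam (Suc k)\<close>.\<close>

lemma tail_at_lam: "1 / 5 \<le> lam k powr (s / 2) * (1 - u (lam k))"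
proof -
  have "2 / pi * (wt k * arctan (lam k / lam k)) \<le> 1 - u (lam k)"
    by (rule one_minus_u_ge[OF l_pos])
  then have "wt k / 2 \<le> 1 - u (lam k)" using l_pos[of k] by (simp add: arctan_one)
  then have "400 ^ k * (wt k / 2) \<le> 400 ^ k * (1 - u (lam k))" by (intro mult_left_mono) auto
  then show ?thesis by (simp add: lam_powr wt_def power_one_over)
qed

text \<open>After multiplication by \<open>20 * 400 ^ k\<close> the later weights contribute 20 /
  400 and the earlier scales at most 40 / 400, since \<open>N >= 400\<close>. The total 3 / 20 lies
  below the level 1 / 5.\<close>

lemma tail_at_N_lam: "(N * lam k) powr (s / 2) * (1 - u (N * lam k)) \<le> 1 / 5"
proof -
  have N: "N > 0" using N_ge by simp
  have "1 - u (N * lam k) \<le> (1 / 400) ^ Suc k + 2 * (lam k * (1 / 400) ^ k) / (N * lam k)"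
    using N l_pos[of k] by (intro one_minus_u_bound) simp
  also have "\<dots> = (1 / 400) ^ k * (1 / 400 + 2 / N)"
    using l_pos[of k] by (simp add: field_simps)
  also have "\<dots> \<le> (1 / 400) ^ k * (1 / 400 + 2 / 400)"
    using N_ge by (intro mult_left_mono add_left_mono divide_left_mono) auto
  finally have "20 * 400 ^ k * (1 - u (N * lam k)) \<le> 20 * 400 ^ k * ((1 / 400) ^ k * (1 / 400 + 2 / 400))"
    by (intro mult_left_mono) auto
  then show ?thesis
    using N l_pos[of k] by (simp add: powr_mult N_powr lam_powr power_one_over)
qed

text \<open>The single scale \<open>lam k\<close> already gives \<open>399 / (400 * pi)\<close>,
  above 1 / 5 because \<open>pi < 4\<close>. The level is the same as for the tail, since one
  constant has to serve both sequences.\<close>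

lemma slope_at_lam: "1 / 5 \<le> lam k powr (1 + s / 2) * v (lam k)"
proof -
  have "2 / pi * (wt k * (lam k / ((lam k)\<^sup>2 + (lam k)\<^sup>2))) \<le> v (lam k)" by (rule v_ge)
  moreover have "2 / pi * (wt k * (lam k / ((lam k)\<^sup>2 + (lam k)\<^sup>2))) = wt k / (pi * lam k)"
    using l_pos[of k] by (simp add: power2_eq_square)
  ultimately have "wt k / (pi * lam k) \<le> v (lam k)" by simp
  then have "lam k * 400 ^ k * (wt k / (pi * lam k)) \<le> lam k * 400 ^ k * v (lam k)"
    using l_pos[of k] by (intro mult_left_mono) auto
  also have "lam k * 400 ^ k * (wt k / (pi * lam k)) = 399 / (400 * pi)"
    using l_pos[of k] by (simp add: wt_def power_one_over)
  finally have "399 / (400 * pi) \<le> lam k powr (1 + s / 2) * v (lam k)"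
    using l_pos[of k] by (simp add: powr_add lam_powr)
  moreover have "1 / 5 \<le> 399 / (400 * pi)" using pi_less_4 by (simp add: divide_simps)
  ultimately show ?thesis by linarith
qed

lemma slope_at_N_lam: "(N * lam k) powr (1 + s / 2) * v (N * lam k) \<le> 1 / 5"
proof -
  define x where "x = N * lam k"
  have x: "x > 0" using N_ge l_pos[of k] by (simp add: x_def)
  have "x powr (1 + s / 2) * v x = x powr (s / 2) * (x * v x)" using x by (simp add: powr_add)
  also have "\<dots> \<le> x powr (s / 2) * (1 - u x)" using x_v_le[OF x] by (intro mult_left_mono) auto
  also have "\<dots> \<le> 1 / 5" unfolding x_def by (rule tail_at_N_lam)
  finally show ?thesis by (simp add: x_def)
qed

lemma lam_at_top: "filterlim lam at_top sequentially"
proof (rule filterlim_at_top_mono[OF filterlim_real_sequentially])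
  have "real k \<le> lam k" for k
  proof -
    have "real k \<le> 2 ^ k" using of_nat_less_two_power[of k, where 'a = real] by linarith
    also have "\<dots> \<le> (N\<^sup>2) ^ k" using N2_ge by (intro power_mono) auto
    finally show ?thesis by (simp add: lam_def)
  qed
  then show "\<forall>\<^sub>F k in sequentially. real k \<le> lam k" by simp
qed

text \<open>The intermediate value theorem on each interval from \<open>lam k\<close> to
  \<open>N * lam k\<close>; the crossing points diverge because they lie above
  \<open>lam k\<close>.\<close>

lemma ex_level_sequence:
  fixes f :: "real \<Rightarrow> real"
  assumes cont: "continuous_on {1..} f"
    and up: "\<And>k. c \<le> f (lam k)" and down: "\<And>k. f (N * lam k) \<le> c"
  obtains x where "\<And>k::nat. 0 < x k" "filterlim x at_top sequentially" "\<And>k. f (x k) = c"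
proof -
  have "\<exists>x. lam k \<le> x \<and> f x = c" for k
  proof -
    have "lam k \<le> N * lam k" using N_ge l_pos[of k] by simp
    moreover have "continuous_on {lam k..N * lam k} f"
      using lam_ge_1[of k] by (intro continuous_on_subset[OF cont]) auto
    ultimately show ?thesis using IVT2'[of f "N * lam k" c "lam k"] up down by blast
  qed
  then obtain x where x: "\<And>k. lam k \<le> x k" "\<And>k. f (x k) = c" by metis
  show ?thesis
  proof (rule that[of x])
    show "0 < x k" for k using x(1)[of k] l_pos[of k] by linarith
    show "filterlim x at_top sequentially"
      by (rule filterlim_at_top_mono[OF lam_at_top]) (simp add: x)
  qed (rule x)
qed

lemma ex_tail_sequence:
  obtains x where "\<And>k::nat. 0 < x k" "filterlim x at_top sequentially"
    "\<And>k. 1 - u (x k) = 1 / 5 * x k powr (- (s / 2))"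
proof -
  have "continuous_on {1..} (\<lambda>x. x powr (s / 2) * (1 - u x))"
    by (intro continuous_intros continuous_on_u) auto
  then obtain x where x: "\<And>k::nat. 0 < x k" "filterlim x at_top sequentially"
    "\<And>k. x k powr (s / 2) * (1 - u (x k)) = 1 / 5"
    using ex_level_sequence[OF _ tail_at_lam tail_at_N_lam] by blast
  have "1 - u (x k) = 1 / 5 * x k powr (- (s / 2))" for k
  proof -
    have "1 - u (x k) = x k powr (s / 2) * (1 - u (x k)) * inverse (x k powr (s / 2))"
      using x(1)[of k] by simp
    then show ?thesis by (simp only: x(3) powr_minus)
  qed
  with x show ?thesis by (intro that[of x]) auto
qed

lemma ex_slope_sequence:
  obtains x where "\<And>k::nat. 0 < x k" "filterlim x at_top sequentially"
    "\<And>k. v (x k) = 1 / 5 * x k powr (- (1 + s / 2))"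
proof -
  have "continuous_on A v" for A
    using DERIV_v by (intro continuous_at_imp_continuous_on ballI) (rule DERIV_isCont)
  then have "continuous_on {1..} (\<lambda>x. x powr (1 + s / 2) * v x)"
    by (intro continuous_intros) auto
  then obtain x where x: "\<And>k::nat. 0 < x k" "filterlim x at_top sequentially"
    "\<And>k. x k powr (1 + s / 2) * v (x k) = 1 / 5"
    using ex_level_sequence[OF _ slope_at_lam slope_at_N_lam] by blast
  have "v (x k) = 1 / 5 * x k powr (- (1 + s / 2))" for k
    using x(1)[of k] x(3)[of k] by (subst powr_minus) (simp add: field_simps)
  with x show ?thesis by (intro that[of x]) auto
qed

section \<open>Signs and parities of the data, and the resulting potential\<close>

lemma g_lim: "(g \<longlongrightarrow> 0) at_top"
  unfolding g_eq[abs_def] using s_pos by (intro tendsto_mult_right_zero mix_tendsto_0) simp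

lemma g_neg: "x > 0 \<Longrightarrow> g x < 0"
  unfolding g_eq using kap_pos s_pos s_less by (intro mult_pos_neg mix_Im_neg) auto

lemma g_odd: "g (-x) = - g x"
  unfolding g_eq using s_pos by (simp add: mix_parity)

lemma g'_even: "g' (-x) = g' x"
  unfolding g'_def using s_pos by (simp add: mix_parity)

lemma ex_W:
  obtains B W \<omega> Z where
    "\<And>t. (W has_real_derivative \<omega> t) (at t)" "\<And>t. (\<omega> has_real_derivative Z t) (at t)"
    "\<And>s t. \<bar>Z s - Z t\<bar> \<le> B * \<bar>s - t\<bar>" "\<And>t. Z (-t) = Z t"
    "\<And>x. Z (u x) = g' x / v x" "\<And>x. \<omega> (u x) = g x" "\<omega> 1 = 0" "\<omega> (-1) = 0"
    "W 1 = 0" "W (-1) = 0" "\<And>t. 0 \<le> W t" "\<And>t. -1 < t \<Longrightarrow> t < 1 \<Longrightarrow> 0 < W t"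
proof -
  obtain B where B: "\<And>x. \<bar>R' x\<bar> \<le> B * v x" using R'_bound by blast
  have even: "g' (-x) / v (-x) = g' x / v x" for x by (simp add: g'_even v_even)
  show ?thesis
    by (rule ex_potential[OF DERIV_u_v v_pos u_odd u_tendsto_1 u_bounds(2) DERIV_g g_odd g_lim g_neg
          DERIV_R B even R_tendsto_0], assumption) (rule that; assumption)
qed

lemma u_onto:
  assumes "u X \<le> t" "t < 1"
  obtains x where "x \<ge> X" "u x = t"
proof -
  obtain a where a: "t < u a" "X \<le> a"
    using eventually_happens[OF eventually_conj[OF order_tendstoD(1)[OF u_tendsto_1 assms(2)]
          eventually_ge_at_top[of X]]] by auto
  then show ?thesis using IVT'[of u X t a] assms continuous_on_u that by fastforce
qed

end

theorem theorem1p5: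
  fixes s :: real
  assumes "0 < s" "s < 1"
  shows "\<exists>(W :: real \<Rightarrow> real) (u :: real \<Rightarrow> real).
    (\<forall>t. 0 \<le> W t) \<and>
    (\<exists>\<theta>. 0 < \<theta> \<and> \<theta> \<le> 1 \<and> C2_holder_loc \<theta> W) \<and>
    W 1 = 0 \<and> W (-1) = 0 \<and> deriv W 1 = 0 \<and> deriv W (-1) = 0 \<and>
    (\<forall>t. -1 < t \<and> t < 1 \<longrightarrow> W t > 0) \<and>
    (\<exists>c1 c2 c3 c4 \<mu> \<alpha> \<beta> \<gamma> \<delta> :: real.
       0 < c1 \<and> c1 \<le> c2 \<and> 0 < c3 \<and> c3 \<le> c4 \<and> 0 < \<mu> \<and> \<mu> < 1 \<and>
       2 \<le> \<beta> \<and> \<beta> \<le> \<alpha> \<and> 2 \<le> \<delta> \<and> \<delta> \<le> \<gamma> \<and>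
       (\<forall>t. -1 < t \<and> t \<le> -1 + \<mu> \<longrightarrow>
          c1 * (1 + t) powr (\<alpha> - 2) \<le> deriv (deriv W) t \<and>
          deriv (deriv W) t \<le> c2 * (1 + t) powr (\<beta> - 2)) \<and>
       (\<forall>t. 1 - \<mu> \<le> t \<and> t < 1 \<longrightarrow>
          c3 * (1 - t) powr (\<gamma> - 2) \<le> deriv (deriv W) t \<and>
          deriv (deriv W) t \<le> c4 * (1 - t) powr (\<delta> - 2)) \<and>
       max (\<alpha> - \<beta>) (\<gamma> - \<delta>) < 1 \<and> min \<beta> \<delta> \<ge> 5 \<and>
       in_X u \<and>
       (\<forall>x. frac_PV_eq s u x (deriv W (u x))) \<and>
       (\<exists>C1 C2 :: real. \<exists>xk yk zk :: nat \<Rightarrow> real.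
          0 < C1 \<and> 0 < C2 \<and>
          (\<forall>k. 0 < xk k \<and> 0 < yk k \<and> 0 < zk k) \<and>
          filterlim xk at_top sequentially \<and> filterlim yk at_top sequentially \<and>
          filterlim zk at_top sequentially \<and>
          (\<forall>k. 1 - u (xk k) = C2 * xk k powr (- (2 * s / (\<gamma> - 1)))) \<and>
          (\<forall>k. 1 - u (yk k) = C1 * yk k powr (- (2 * s / (\<delta> - 1)))) \<and>
          (\<forall>k. 1 + u (- xk k) = C2 * \<bar>xk k\<bar> powr (- (2 * s / (\<alpha> - 1)))) \<and>
          (\<forall>k. 1 + u (- yk k) = C1 * \<bar>yk k\<bar> powr (- (2 * s / (\<beta> - 1)))) \<and>
          (\<forall>k. (u has_real_derivative
               C1 * zk k powr (- (1 + 2 * s * (\<gamma> - \<delta> + 1) / (\<gamma> - 1)))) (at (zk k))) \<and>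
          (\<forall>k. (u has_real_derivative
               C1 * \<bar>zk k\<bar> powr (- (1 + 2 * s * (\<alpha> - \<beta> + 1) / (\<alpha> - 1)))) (at (- zk k)))))"
proof -
  interpret frac_order s using assms by unfold_locales
  obtain B W \<omega> Z where dW: "\<And>t. (W has_real_derivative \<omega> t) (at t)"
    and d\<omega>: "\<And>t. (\<omega> has_real_derivative Z t) (at t)"
    and lip: "\<And>s t. \<bar>Z s - Z t\<bar> \<le> B * \<bar>s - t\<bar>" and Z_even: "\<And>t. Z (-t) = Z t"
    and Zu: "\<And>x. Z (u x) = g' x / v x" and \<omega>u: "\<And>x. \<omega> (u x) = g x"
    and \<omega>1: "\<omega> 1 = 0" "\<omega> (-1) = 0" and W1: "W 1 = 0" "W (-1) = 0"
    and W: "\<And>t. 0 \<le> W t" "\<And>t. -1 < t \<Longrightarrow> t < 1 \<Longrightarrow> 0 < W t"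
    by (rule ex_W) (rule that; assumption)
  have derivW: "deriv W = \<omega>" using dW by (intro ext DERIV_imp_deriv)
  have deriv\<omega>: "deriv \<omega> = Z" using d\<omega> by (intro ext DERIV_imp_deriv)
  have holder: "C2_holder_loc 1 W"
    unfolding C2_holder_loc_def derivW deriv\<omega>
  proof (intro conjI allI impI)
    show "W differentiable at t" "\<omega> differentiable at t" for t
      using dW d\<omega> real_differentiable_def by blast+
    show "\<exists>C. \<forall>x\<in>K. \<forall>y\<in>K. \<bar>Z x - Z y\<bar> \<le> C * \<bar>x - y\<bar> powr 1" for K
      using lip by (intro exI[of _ B]) simp
  qed
  obtain X c3 c4 where X: "X \<ge> 1" and c: "0 < c3" "0 < c4"
    and growth: "\<And>x. x \<ge> X \<Longrightarrow> c3 * (1 - u x) ^ 3 \<le> g' x / v x \<and> g' x / v x \<le> c4 * (1 - u x) ^ 3"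
    using potential_growth by blast
  \<comment> \<open>With this choice the interval from \<open>1 - \<mu>\<close> to 1 is the image
    under \<open>u\<close> of the points \<open>x >= X\<close>, where the growth bounds hold;
    \<open>\<mu> < 1\<close> because \<open>u X > u 0 = 0\<close>.\<close>
  define \<mu> where "\<mu> = 1 - u X"
  have "u 0 < u X" using X strict_monoD[OF u_strict_mono, of 0 X] by simp
  then have \<mu>: "0 < \<mu>" "\<mu> < 1" using u_odd[of 0] u_bounds[of X] by (auto simp: \<mu>_def)
  \<comment> \<open>The bounds in \<open>growth\<close> come with no order between \<open>c3\<close>
    and \<open>c4\<close>; taking \<open>max c3 c4\<close> above supplies the inequality between the
    constants demanded by (W3).\<close>
  have right: "c3 * (1 - t) ^ 3 \<le> Z t \<and> Z t \<le> max c3 c4 * (1 - t) ^ 3" if "1 - \<mu> \<le> t" "t < 1" for t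
  proof -
    obtain x where x: "x \<ge> X" "u x = t" using u_onto[of X t] \<open>1 - \<mu> \<le> t\<close> \<open>t < 1\<close> by (auto simp: \<mu>_def)
    have "c4 * (1 - t) ^ 3 \<le> max c3 c4 * (1 - t) ^ 3" using that by (intro mult_right_mono) auto
    with growth[OF x(1)] Zu[of x] x show ?thesis by auto
  qed
  have left: "c3 * (1 + t) ^ 3 \<le> Z t \<and> Z t \<le> max c3 c4 * (1 + t) ^ 3" if "-1 < t" "t \<le> -1 + \<mu>" for t
    using right[of "-t"] that Z_even[of t] by simp
  obtain xk where xk: "\<And>k::nat. 0 < xk k" "filterlim xk at_top sequentially"
    "\<And>k. 1 - u (xk k) = 1 / 5 * xk k powr (- (s / 2))"
    by (rule ex_tail_sequence) (rule that; assumption)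
  obtain zk where zk: "\<And>k::nat. 0 < zk k" "filterlim zk at_top sequentially"
    "\<And>k. v (zk k) = 1 / 5 * zk k powr (- (1 + s / 2))"
    by (rule ex_slope_sequence) (rule that; assumption)
  have du: "(u has_real_derivative 1 / 5 * zk k powr (- (1 + s / 2))) (at (zk k))"
    "(u has_real_derivative 1 / 5 * \<bar>zk k\<bar> powr (- (1 + s / 2))) (at (- zk k))" for k
    using DERIV_u_v[of "zk k"] DERIV_u_v[of "- zk k"] zk(1)[of k] zk(3)[of k] by (simp_all add: v_even)
  have left_xk: "1 + u (- xk k) = 1 / 5 * \<bar>xk k\<bar> powr (- (s / 2))" for k
    using xk(1)[of k] xk(3)[of k] by (simp add: u_odd)
  have pde: "frac_PV_eq s u x (\<omega> (u x))" for x
    unfolding \<omega>u g_def by (rule frac_PV_eq_u[OF assms])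
  \<comment> \<open>All four exponents being 5, the tail conditions for x_k and y_k coincide: both
    constants are 1 / 5 and \<open>xk\<close> serves twice.\<close>
  have "\<exists>C1 C2 :: real. \<exists>xk yk zk :: nat \<Rightarrow> real.
          0 < C1 \<and> 0 < C2 \<and>
          (\<forall>k. 0 < xk k \<and> 0 < yk k \<and> 0 < zk k) \<and>
          filterlim xk at_top sequentially \<and> filterlim yk at_top sequentially \<and>
          filterlim zk at_top sequentially \<and>
          (\<forall>k. 1 - u (xk k) = C2 * xk k powr (- (s / 2))) \<and>
          (\<forall>k. 1 - u (yk k) = C1 * yk k powr (- (s / 2))) \<and>
          (\<forall>k. 1 + u (- xk k) = C2 * \<bar>xk k\<bar> powr (- (s / 2))) \<and>
          (\<forall>k. 1 + u (- yk k) = C1 * \<bar>yk k\<bar> powr (- (s / 2))) \<and>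
          (\<forall>k. (u has_real_derivative
               C1 * zk k powr (- (1 + s / 2))) (at (zk k))) \<and>
          (\<forall>k. (u has_real_derivative
               C1 * \<bar>zk k\<bar> powr (- (1 + s / 2))) (at (- zk k)))"
    by (rule exI[of _ "1 / 5"], rule exI[of _ "1 / 5"], rule exI[of _ xk], rule exI[of _ xk],
        rule exI[of _ zk], intro conjI allI) (rule xk zk du left_xk | simp)+
  note seqs = this
  have left': "\<forall>t. -1 < t \<and> t \<le> -1 + \<mu> \<longrightarrow>
      c3 * (1 + t) powr 3 \<le> Z t \<and> Z t \<le> max c3 c4 * (1 + t) powr 3"
    using left by simp
  have right': "\<forall>t. 1 - \<mu> \<le> t \<and> t < 1 \<longrightarrow>
      c3 * (1 - t) powr 3 \<le> Z t \<and> Z t \<le> max c3 c4 * (1 - t) powr 3"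
    using right by simp
  have exps: "(5::real) - 2 = 3" "2 * s / (5 - 1) = s / 2" "1 + 2 * s * (5 - 5 + 1) / (5 - 1) = 1 + s / 2"
    by simp_all
  have main: "\<exists>c1 c2 c3 c4 \<mu> \<alpha> \<beta> \<gamma> \<delta>.
       0 < c1 \<and> c1 \<le> c2 \<and> 0 < c3 \<and> c3 \<le> c4 \<and> 0 < \<mu> \<and> \<mu> < 1 \<and>
       2 \<le> \<beta> \<and> \<beta> \<le> \<alpha> \<and> 2 \<le> \<delta> \<and> \<delta> \<le> \<gamma> \<and>
       (\<forall>t. -1 < t \<and> t \<le> -1 + \<mu> \<longrightarrow>
          c1 * (1 + t) powr (\<alpha> - 2) \<le> Z t \<and>
          Z t \<le> c2 * (1 + t) powr (\<beta> - 2)) \<and>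
       (\<forall>t. 1 - \<mu> \<le> t \<and> t < 1 \<longrightarrow>
          c3 * (1 - t) powr (\<gamma> - 2) \<le> Z t \<and>
          Z t \<le> c4 * (1 - t) powr (\<delta> - 2)) \<and>
       max (\<alpha> - \<beta>) (\<gamma> - \<delta>) < 1 \<and> min \<beta> \<delta> \<ge> 5 \<and>
       in_X u \<and>
       (\<forall>x. frac_PV_eq s u x (\<omega> (u x))) \<and>
       (\<exists>C1 C2 :: real. \<exists>xk yk zk :: nat \<Rightarrow> real.
          0 < C1 \<and> 0 < C2 \<and>
          (\<forall>k. 0 < xk k \<and> 0 < yk k \<and> 0 < zk k) \<and>
          filterlim xk at_top sequentially \<and> filterlim yk at_top sequentially \<and>
          filterlim zk at_top sequentially \<and>
          (\<forall>k. 1 - u (xk k) = C2 * xk k powr (- (2 * s / (\<gamma> - 1)))) \<and>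
          (\<forall>k. 1 - u (yk k) = C1 * yk k powr (- (2 * s / (\<delta> - 1)))) \<and>
          (\<forall>k. 1 + u (- xk k) = C2 * \<bar>xk k\<bar> powr (- (2 * s / (\<alpha> - 1)))) \<and>
          (\<forall>k. 1 + u (- yk k) = C1 * \<bar>yk k\<bar> powr (- (2 * s / (\<beta> - 1)))) \<and>
          (\<forall>k. (u has_real_derivative
               C1 * zk k powr (- (1 + 2 * s * (\<gamma> - \<delta> + 1) / (\<gamma> - 1)))) (at (zk k))) \<and>
          (\<forall>k. (u has_real_derivative
               C1 * \<bar>zk k\<bar> powr (- (1 + 2 * s * (\<alpha> - \<beta> + 1) / (\<alpha> - 1)))) (at (- zk k))))"
    by (rule exI[of _ c3], rule exI[of _ "max c3 c4"], rule exI[of _ c3], rule exI[of _ "max c3 c4"],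
        rule exI[of _ \<mu>], (rule exI[of _ 5])+, unfold exps, intro conjI)
      (rule c \<mu> left' right' in_X_u seqs pde allI | simp)+
  have W_sign: "\<forall>t. 0 \<le> W t" "\<forall>t. -1 < t \<and> t < 1 \<longrightarrow> W t > 0" using W by auto
  have regular: "\<exists>\<theta>. 0 < \<theta> \<and> \<theta> \<le> 1 \<and> C2_holder_loc \<theta> W"
    using holder by (intro exI[of _ 1]) simp
  show ?thesis
    by (rule exI[of _ W], rule exI[of _ u], unfold derivW deriv\<omega>, intro conjI)
      (rule main W_sign regular W1 \<omega>1)+
qed

end
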